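(* Let $S$ be a polynomial ring over a field, and let $I$ be a complete intersection ideal of $S$ whose minimal set of monomial generators is $\{u_1,\dots,u_s\}$ (so $u_1,\dots,u_s$ are monomials forming a regular sequence in $S$), ordered so that $\deg(u_1)\geq\cdots\geq\deg(u_s)$. Then for all $n\geq 1$, \[\mathrm{reg}(I^n)=n\deg(u_1)+\sum_{j=2}^{s}\deg(u_j)-(s-1).\]
   Context: $S$ is a polynomial ring in finitely many variables over a field, with the standard grading, and $\mathfrak{m}$ is its maximal homogeneous ideal. An ideal $I=(u_1,\dots,u_s)$, $s\geq 1$, is called a complete intersection if $u_1,\dots,u_s$ is a regular sequence of $S$. For a finitely generated graded $S$-module $M$, put $a^i(M)=\max\{t\mid [H^i_{\mathfrak{m}}(M)]_t\neq 0\}$, with $a^i(M)=-\infty$ if $H^i_{\mathfrak{m}}(M)=0$; the Castelnuovo-Mumford regularity of $M$ is $\mathrm{reg}(M)=\max_{i\geq 0}\{a^i(M)+i\}$. Here $\mathrm{reg}(I^n)$ is the regularity of the ideal $I^n$ viewed as a graded $S$-module. *)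

theory Defs
  imports "HOL-Library.Poly_Mapping" "HOL-Library.Extended_Real"
begin

section \<open>The polynomial ring\<close>

text \<open>
  The variables are indexed by a finite type. Its linear order is used only for the signs in
  the Cech complex (and every finite type can be ordered).
\<close>

type_synonym ('n, 'k) mpoly = "('n \<Rightarrow>\<^sub>0 nat) \<Rightarrow>\<^sub>0 'k"

definition Var :: "'n \<Rightarrow> ('n, 'k::comm_ring_1) mpoly" where
  "Var i = Poly_Mapping.single (Poly_Mapping.single i 1) 1"

definition mono_deg :: "('n::finite \<Rightarrow>\<^sub>0 nat) \<Rightarrow> nat" where
  "mono_deg e = (\<Sum>i\<in>UNIV. Poly_Mapping.lookup e i)"

definition is_monomial :: "('n, 'k::comm_ring_1) mpoly \<Rightarrow> bool" where
  "is_monomial f \<longleftrightarrow> (\<exists>e. f = Poly_Mapping.single e 1)"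

text \<open>Total degree; only meaningful for nonzero polynomials.\<close>

definition deg :: "('n::finite, 'k::comm_ring_1) mpoly \<Rightarrow> nat" where
  "deg f = Max (mono_deg ` Poly_Mapping.keys f)"

text \<open>The graded component of degree \<open>t\<close> in the standard grading; it is zero for \<open>t < 0\<close>.\<close>

definition hom_comp :: "int \<Rightarrow> ('n::finite, 'k::comm_ring_1) mpoly set" where
  "hom_comp t = {f. \<forall>e\<in>Poly_Mapping.keys f. int (mono_deg e) = t}"


section \<open>Ideals and regular sequences\<close>

definition ideal_gen :: "'a::comm_ring_1 set \<Rightarrow> 'a set" where
  "ideal_gen = module.span (*)"

fun ideal_pow :: "'a::comm_ring_1 set \<Rightarrow> nat \<Rightarrow> 'a set" where
  "ideal_pow I 0 = UNIV"
| "ideal_pow I (Suc n) = ideal_gen {a * b | a b. a \<in> ideal_pow I n \<and> b \<in> I}"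

definition regular_sequence :: "'a::comm_ring_1 list \<Rightarrow> bool" where
  "regular_sequence us \<longleftrightarrow>
     (\<forall>i<length us. \<forall>f. us ! i * f \<in> ideal_gen (set (take i us)) \<longrightarrow>
                        f \<in> ideal_gen (set (take i us)))
     \<and> ideal_gen (set us) \<noteq> UNIV"

definition minimal_monomial_generators ::
  "('n, 'k::comm_ring_1) mpoly set \<Rightarrow> ('n, 'k) mpoly set \<Rightarrow> bool" where
  "minimal_monomial_generators I G \<longleftrightarrow>
     (\<forall>g\<in>G. is_monomial g) \<and> ideal_gen G = I \<and> (\<forall>H. H \<subset> G \<longrightarrow> ideal_gen H \<noteq> I)"


section \<open>Graded modules, local cohomology and regularity\<close>

text \<open>
  The graded module is \<open>M = \<Oplus>\<^sub>t gr t\<close>, a submodule of the ambient module given by the type \<open>'m\<close>.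
\<close>

locale graded_module = module scale
  for scale :: "('n::{finite,linorder}, 'k::field) mpoly \<Rightarrow> 'm::ab_group_add \<Rightarrow> 'm" +
  fixes gr :: "int \<Rightarrow> 'm set"
  assumes gr_zero: "0 \<in> gr t"
    and gr_add: "x \<in> gr t \<Longrightarrow> y \<in> gr t \<Longrightarrow> x + y \<in> gr t"
    and gr_scale: "f \<in> hom_comp d \<Longrightarrow> x \<in> gr t \<Longrightarrow> scale f x \<in> gr (t + d)"
    and gr_direct: "finite T \<Longrightarrow> (\<And>t. t \<in> T \<Longrightarrow> h t \<in> gr t) \<Longrightarrow> (\<Sum>t\<in>T. h t) = 0 \<Longrightarrow>
                    t \<in> T \<Longrightarrow> h t = 0"
begin

text \<open>
  Local cohomology with support in the ideal generated by the variables is the cohomology of the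
  Cech complex
  \<open>0 \<rightarrow> M \<rightarrow> \<Oplus>\<^sub>i M[1/x\<^sub>i] \<rightarrow> \<Oplus>\<^sub>i\<^sub><\<^sub>j M[1/(x\<^sub>i x\<^sub>j)] \<rightarrow> \<dots>\<close>.
  Its term in position \<open>p\<close> is the sum, over the sets \<open>F\<close> of \<open>p\<close> variables, of the localizations of
  \<open>M\<close> at \<open>x\<^sub>F = (\<Prod>i\<in>F. x\<^sub>i)\<close>.  As there are finitely many \<open>F\<close>, the components of a cochain can be
  written as fractions \<open>m F / x\<^sub>F ^ k\<close> with a common exponent \<open>k\<close>; the pair \<open>(m, k)\<close> represents this
  cochain, and \<open>cech_eq p\<close> is equality of the represented cochains in position \<open>p\<close>.
\<close>

definition var_prod :: "'n set \<Rightarrow> ('n, 'k) mpoly" where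
  "var_prod F = (\<Prod>i\<in>F. Var i)"

fun frac_eq :: "'n set \<Rightarrow> 'm \<times> nat \<Rightarrow> 'm \<times> nat \<Rightarrow> bool" where
  "frac_eq F (a, k) (b, l) \<longleftrightarrow>
     (\<exists>r. scale (var_prod F ^ r) (scale (var_prod F ^ l) a - scale (var_prod F ^ k) b) = 0)"

fun cech_eq :: "nat \<Rightarrow> ('n set \<Rightarrow> 'm) \<times> nat \<Rightarrow> ('n set \<Rightarrow> 'm) \<times> nat \<Rightarrow> bool" where
  "cech_eq p (m, k) (m', k') \<longleftrightarrow> (\<forall>F. card F = p \<longrightarrow> frac_eq F (m F, k) (m' F, k'))"

fun cech_diff ::
  "('n set \<Rightarrow> 'm) \<times> nat \<Rightarrow> ('n set \<Rightarrow> 'm) \<times> nat \<Rightarrow> ('n set \<Rightarrow> 'm) \<times> nat" where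
  "cech_diff (m, k) (m', k') =
     (\<lambda>F. scale (var_prod F ^ k') (m F) - scale (var_prod F ^ k) (m' F), k + k')"

text \<open>
  The differential: \<open>m (F - {j}) / x\<^bsub>F - {j}\<^esub> ^ k\<close> is rewritten over \<open>x\<^sub>F ^ k\<close>.
\<close>

fun cech_d :: "('n set \<Rightarrow> 'm) \<times> nat \<Rightarrow> ('n set \<Rightarrow> 'm) \<times> nat" where
  "cech_d (m, k) =
     (\<lambda>F. \<Sum>j\<in>F. scale ((-1) ^ card {i \<in> F. i < j} * Var j ^ k) (m (F - {j})), k)"

text \<open>The degree \<open>t\<close> part; note that \<open>x\<^sub>F ^ k\<close> has degree \<open>k * card F\<close>.\<close>

definition cech_cochains :: "nat \<Rightarrow> int \<Rightarrow> (('n set \<Rightarrow> 'm) \<times> nat) set" where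
  "cech_cochains p t = {(m, k). \<forall>F. card F = p \<longrightarrow> m F \<in> gr (t + int (k * p))}"

definition cech_cocycles :: "nat \<Rightarrow> int \<Rightarrow> (('n set \<Rightarrow> 'm) \<times> nat) set" where
  "cech_cocycles p t = {c \<in> cech_cochains p t. cech_eq (Suc p) (cech_d c) (\<lambda>_. 0, 0)}"

definition cech_coboundaries :: "nat \<Rightarrow> int \<Rightarrow> (('n set \<Rightarrow> 'm) \<times> nat) set" where
  "cech_coboundaries p t = {c \<in> cech_cochains p t.
     case p of 0 \<Rightarrow> cech_eq 0 c (\<lambda>_. 0, 0)
             | Suc q \<Rightarrow> \<exists>b\<in>cech_cochains q t. cech_eq p c (cech_d b)}"

text \<open>The degree \<open>t\<close> component of the \<open>p\<close>-th local cohomology module; its zero element is the class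
  \<open>cech_coboundaries p t\<close>.\<close>

definition local_cohomology :: "nat \<Rightarrow> int \<Rightarrow> (('n set \<Rightarrow> 'm) \<times> nat) set set" where
  "local_cohomology p t = cech_cocycles p t //
     {(c, c'). c \<in> cech_cocycles p t \<and> c' \<in> cech_cocycles p t \<and>
               cech_diff c c' \<in> cech_coboundaries p t}"

text \<open>
  For a finitely generated module the suprema below are maxima. In any case, a supremum
  in \<open>ereal\<close> of integers and \<open>- \<infinity>\<close> that is finite is attained, and \<open>Sup {} = - \<infinity>\<close>.
\<close>

definition a_invariant :: "nat \<Rightarrow> ereal" where
  "a_invariant p =
     (SUP t\<in>{t. local_cohomology p t \<noteq> {cech_coboundaries p t}}. ereal (of_int t))"

definition regularity :: ereal where
  "regularity = (SUP p. a_invariant p + ereal (of_nat p))"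

end

text \<open>The regularity of a homogeneous ideal, viewed as a graded module.\<close>

definition ideal_reg :: "('n::{finite,linorder}, 'k::field) mpoly set \<Rightarrow> ereal" where
  "ideal_reg J = graded_module.regularity (*) (\<lambda>t. J \<inter> hom_comp t)"

lemma module_mult: "module ((*) :: 'a::comm_ring_1 \<Rightarrow> 'a \<Rightarrow> 'a)"
  by unfold_locales (auto simp: algebra_simps)

lemma mono_deg_add: "mono_deg (a + b) = mono_deg a + mono_deg b"
  by (simp add: mono_deg_def lookup_add sum.distrib)

lemma hom_comp_mult:
  assumes "f \<in> hom_comp d" "g \<in> hom_comp t"
  shows "f * g \<in> hom_comp (t + d)"
proof -
  have "int (mono_deg e) = t + d" if e: "e \<in> Poly_Mapping.keys (f * g)" for e
  proof -
    obtain a b where "e = a + b" "a \<in> Poly_Mapping.keys f" "b \<in> Poly_Mapping.keys g"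
      using e keys_mult[of f g] by blast
    then show ?thesis using assms by (simp add: hom_comp_def mono_deg_add)
  qed
  then show ?thesis by (simp add: hom_comp_def)
qed

lemma graded_module_ideal:
  fixes J :: "('n::{finite,linorder}, 'k::field) mpoly set"
  assumes J: "module.subspace (*) J"
  shows "graded_module (*) (\<lambda>t. J \<inter> hom_comp t)"
proof -
  interpret M: module "(*) :: ('n, 'k) mpoly \<Rightarrow> ('n, 'k) mpoly \<Rightarrow> ('n, 'k) mpoly"
    by (rule module_mult)
  show ?thesis
  proof
    show "0 \<in> J \<inter> hom_comp t" for t
      using M.subspace_0[OF J] by (simp add: hom_comp_def)
    show "x + y \<in> J \<inter> hom_comp t" if "x \<in> J \<inter> hom_comp t" "y \<in> J \<inter> hom_comp t" for x y t
      using that M.subspace_add[OF J] Poly_Mapping.keys_add[of x y]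
      unfolding hom_comp_def by blast
    show "f * x \<in> J \<inter> hom_comp (t + d)" if "f \<in> hom_comp d" "x \<in> J \<inter> hom_comp t" for f d x t
      using that M.subspace_scale[OF J] hom_comp_mult by blast
    show "x t = 0" if T: "finite T" and x: "\<And>t. t \<in> T \<Longrightarrow> x t \<in> J \<inter> hom_comp t"
      and s: "(\<Sum>t\<in>T. x t) = 0" and t: "t \<in> T" for T t and x :: "int \<Rightarrow> ('n, 'k) mpoly"
    proof (rule poly_mapping_eqI)
      fix e
      show "Poly_Mapping.lookup (x t) e = Poly_Mapping.lookup 0 e"
      proof (cases "int (mono_deg e) = t")
        case True
        have "Poly_Mapping.lookup (x t') e = 0" if "t' \<in> T - {t}" for t'
          using x[of t'] that True by (auto simp: hom_comp_def in_keys_iff)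
        then have "(\<Sum>t'\<in>T. Poly_Mapping.lookup (x t') e) = Poly_Mapping.lookup (x t) e"
          using T t by (simp add: sum.remove)
        then show ?thesis using s by (metis lookup_sum lookup_zero)
      next
        case False
        then show ?thesis using x[OF t] by (auto simp: hom_comp_def in_keys_iff)
      qed
    qed
  qed
qed

end

theory Submission
  imports Defs
begin

text \<open>
  The generators \<open>u\<^sub>1, \<dots>, u\<^sub>s\<close> are pairwise coprime (\<open>regular_sequence_coprime\<close>): for monomials,
  this is what a regular sequence of minimal generators means. So the powers \<open>I\<^sup>n\<close> are known
  explicitly: a monomial lies in \<open>I\<^sup>n\<close> iff it is divisible by some \<open>u\<^sub>1 ^ c 1 * \<dots> * u\<^sub>s ^ c s\<close>
  with \<open>c 1 + \<dots> + c s = n\<close>, and divisibility can be tested separately on the disjoint groups of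
  variables that occur in the \<open>u\<^sub>i\<close>.

  The Cech complex of a monomial ideal splits into its parts of multidegree \<open>\<alpha>\<close>, where \<open>\<alpha>\<close> is an
  integer vector. Such a part is a finite complex of vector spaces with one basis vector for
  every set \<open>F\<close> of variables such that \<open>x\<^sup>\<alpha>\<close> lies in the localization at \<open>F\<close>. By
  \<open>regularity_eqI\<close> the regularity is the largest value of \<open>|\<alpha>| + p\<close> such that this complex is
  not exact in position \<open>p\<close>.

  For \<open>I\<^sup>n\<close> let \<open>M i\<close> be the largest power of \<open>u\<^sub>i\<close> allowed by one single variable of its group
  that has a nonnegative exponent in \<open>x\<^sup>\<alpha>\<close>. (Without such a variable in some group, the complex
  is a cone or all exponents are negative.) If \<open>M 1 + \<dots> + M s \<ge> n\<close>, the complex is contracted by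
  an acyclic matching (\<open>exact_at_large_quotients\<close>). Otherwise \<open>x\<^sup>\<alpha>\<close> lies in a localization only if
  all variables of a group are inverted; then there is no cohomology above position \<open>N - s + 1\<close>,
  with \<open>N\<close> the number of variables, and \<open>|\<alpha>| + N \<le> \<Sum>i. (M i + 1) * deg u\<^sub>i\<close>. Since
  \<open>M 1 + \<dots> + M s \<le> n - 1\<close>, this is largest when the whole of \<open>n - 1\<close> is spent on the generator
  of largest degree. This gives the upper bound (\<open>exact_at_above_reg\<close>; where all exponents are
  negative, \<open>|\<alpha>| + p \<le> 0\<close>). The bound is attained, as the complex for that multidegree is not
  exact in position \<open>N - s + 1\<close>: it computes the homology of the boundary of a simplex with \<open>s\<close>
  vertices (\<open>not_exact_at_missing_group\<close>).
\<close>

section \<open>Cochains on families of sets\<close>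

text \<open>
  The sign attached to \<open>j\<close> in the Cech differential. By the next definition, for a fixed
  multidegree the Cech complex is the cochain complex of the full simplex on the variables, cut
  down to a family of sets of variables.
\<close>

definition cech_sign :: "'n::linorder \<Rightarrow> 'n set \<Rightarrow> 'k::comm_ring_1" where
  "cech_sign j F = (-1) ^ card {i \<in> F. i < j}"

definition cobd :: "('n::linorder set \<Rightarrow> 'k::comm_ring_1) \<Rightarrow> 'n set \<Rightarrow> 'k" where
  "cobd f F = (\<Sum>j\<in>F. cech_sign j F * f (F - {j}))"

lemma cech_sign_square [simp]:
  fixes x :: "'k::comm_ring_1"
  shows "cech_sign j F * (cech_sign j F * x) = x"
  by (cases "even (card {i \<in> F. i < j})") (simp_all add: cech_sign_def)

lemma cech_sign_prod:
  assumes "finite F"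
  shows "cech_sign j F = (\<Prod>i\<in>F. if i < j then - 1 else (1 :: 'k::comm_ring_1))"
  using assms by (simp add: cech_sign_def prod.If_cases Int_def)

lemma cobd_diff: "cobd (\<lambda>F. f F - g F) F = cobd f F - cobd g F"
  by (simp add: cobd_def algebra_simps sum_subtractf)

lemma cobd_add: "cobd (\<lambda>F. f F + g F) F = cobd f F + cobd g F"
  by (simp add: cobd_def algebra_simps sum.distrib)

lemma cobd_cobd:
  fixes f :: "'n::linorder set \<Rightarrow> 'k::comm_ring_1"
  assumes fin: "finite F"
  shows "cobd (cobd f) F = 0"
proof -
  define T where "T = (\<lambda>j i. cech_sign j F * (cech_sign i (F - {j}) * f (F - {j} - {i})))"
  let ?L = "{(j, i). j \<in> F \<and> i \<in> F \<and> i < j}" and ?G = "{(j, i). j \<in> F \<and> i \<in> F \<and> j < i}"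
  have finL: "finite ?L" and finG: "finite ?G"
    by (rule finite_subset[of _ "F \<times> F"]; use fin in auto)+
  have swap: "T i j = - T j i" if "i \<in> F" "j \<in> F" "i < j" for i j
  proof -
    have "{k \<in> F. k < j} = insert i {k \<in> F - {i}. k < j}" using that by auto
    then have 1: "cech_sign j F = (- cech_sign j (F - {i}) :: 'k)"
      using fin by (simp add: cech_sign_def)
    have "{k \<in> F - {j}. k < i} = {k \<in> F. k < i}" using that by auto
    then have 2: "cech_sign i (F - {j}) = (cech_sign i F :: 'k)" by (simp add: cech_sign_def)
    have 3: "F - {j} - {i} = F - {i} - {j}" by auto
    show ?thesis unfolding T_def 1 2 3 by (simp add: mult.left_commute)
  qed
  have "cobd (cobd f) F = (\<Sum>j\<in>F. \<Sum>i\<in>F - {j}. T j i)"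
    by (simp add: cobd_def T_def sum_distrib_left)
  also have "\<dots> = (\<Sum>(j, i)\<in>Sigma F (\<lambda>j. F - {j}). T j i)"
    using fin by (simp add: sum.Sigma)
  also have "Sigma F (\<lambda>j. F - {j}) = ?L \<union> ?G" by auto
  also have "(\<Sum>(j, i)\<in>?L \<union> ?G. T j i) = (\<Sum>(j, i)\<in>?L. T j i) + (\<Sum>(j, i)\<in>?G. T j i)"
    by (rule sum.union_disjoint) (use finL finG in auto)
  also have "(\<Sum>(j, i)\<in>?G. T j i) = (\<Sum>(j, i)\<in>?L. - T j i)"
    by (rule sum.reindex_bij_witness[of _ prod.swap prod.swap]) (simp_all add: case_prod_unfold swap split: prod.splits)
  finally show ?thesis by (simp add: sum_negf case_prod_unfold)
qed

text \<open>
  Exactness in position \<open>p\<close> of the complex of functions supported on \<open>\<Delta>\<close>. A cochain in position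
  \<open>p\<close> is a function of which only the values on sets of cardinality \<open>p\<close> are looked at, so that
  positions need no separate types. For \<open>p = 0\<close> the condition on \<open>g\<close> says that \<open>f {} = 0\<close>, since
  an empty sum is \<open>0\<close>. The first argument only fixes the coefficient ring.
\<close>

definition exact_at :: "'k::comm_ring_1 itself \<Rightarrow> 'n::linorder set set \<Rightarrow> nat \<Rightarrow> bool" where
  "exact_at K \<Delta> p \<longleftrightarrow>
     (\<forall>f :: 'n set \<Rightarrow> 'k. (\<forall>F. f F \<noteq> 0 \<longrightarrow> F \<in> \<Delta>) \<longrightarrow> (\<forall>F. card F = Suc p \<longrightarrow> cobd f F = 0) \<longrightarrow>
        (\<exists>g. (\<forall>F. g F \<noteq> 0 \<longrightarrow> F \<in> \<Delta>) \<and> (\<forall>F. card F = p \<longrightarrow> f F = cobd g F)))"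

definition up_closed :: "'a set set \<Rightarrow> bool" where
  "up_closed \<Delta> \<longleftrightarrow> (\<forall>F F'. F \<in> \<Delta> \<longrightarrow> F \<subseteq> F' \<longrightarrow> F' \<in> \<Delta>)"

lemma cobd_supported:
  assumes "up_closed \<Delta>" and "\<forall>F. g F \<noteq> 0 \<longrightarrow> F \<in> \<Delta>"
    and "cobd g F \<noteq> 0"
  shows "F \<in> \<Delta>"
proof -
  have "\<exists>j. g (F - {j}) \<noteq> 0"
  proof (rule ccontr)
    assume "\<not> (\<exists>j. g (F - {j}) \<noteq> 0)"
    then have "cobd g F = 0" by (simp add: cobd_def)
    then show False using assms(3) by contradiction
  qed
  then obtain j where "g (F - {j}) \<noteq> 0" by (elim exE)
  then have "F - {j} \<in> \<Delta>" using assms(2) by simp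
  then show ?thesis using assms(1) unfolding up_closed_def by (meson Diff_subset)
qed

text \<open>
  If deleting a fixed element \<open>v\<close> never leaves \<open>\<Delta>\<close>, then \<open>\<Delta>\<close> is a cone and
  \<open>f \<mapsto> \<plusminus> f (insert v F)\<close> is a contracting homotopy. Here the element may depend on a rank that
  grows with the set: the sets of one rank form a cone, and a cocycle is made zero rank after
  rank, lower ranks being left alone because the correction \<open>h\<close> is supported on a single rank.
  This is an acyclic matching of discrete Morse theory without critical sets.
\<close>

lemma exact_at_matching:
  fixes \<Delta> :: "'n::{finite,linorder} set set" and rk :: "'n set \<Rightarrow> nat" and v :: "nat \<Rightarrow> 'n"
  assumes up: "up_closed \<Delta>"
    and down: "\<And>F. F \<in> \<Delta> \<Longrightarrow> F - {v (rk F)} \<in> \<Delta>"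
    and mono: "\<And>F F'. F \<subseteq> F' \<Longrightarrow> rk F \<le> rk F'"
    and rk: "\<And>F. rk (insert (v (rk F)) F) = rk F" "\<And>F. rk (F - {v (rk F)}) = rk F"
  shows "exact_at (K :: 'k::comm_ring_1 itself) \<Delta> p"
  unfolding exact_at_def
proof (intro allI impI)
  fix f :: "'n set \<Rightarrow> 'k"
  assume supp: "\<forall>F. f F \<noteq> 0 \<longrightarrow> F \<in> \<Delta>" and cyc: "\<forall>F. card F = Suc p \<longrightarrow> cobd f F = 0"
  have "\<exists>g. (\<forall>F. g F \<noteq> 0 \<longrightarrow> F \<in> \<Delta>) \<and> (\<forall>F. card F = p \<longrightarrow> rk F < r \<longrightarrow> f F = cobd g F)" for r
  proof (induction r)
    case 0
    show ?case by (rule exI[of _ "\<lambda>_. 0"]) simp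
  next
    case (Suc r)
    then obtain g where g: "\<forall>F. g F \<noteq> 0 \<longrightarrow> F \<in> \<Delta>"
      "\<And>F. card F = p \<Longrightarrow> rk F < r \<Longrightarrow> f F = cobd g F" by blast
    define f' where "f' = (\<lambda>F. f F - cobd g F)"
    define h where "h = (\<lambda>F. if rk F = r \<and> v r \<notin> F
      then cech_sign (v r) (insert (v r) F) * f' (insert (v r) F) else 0)"
    have supp': "F \<in> \<Delta>" if "f' F \<noteq> 0" for F
    proof -
      have "f F \<noteq> 0 \<or> cobd g F \<noteq> 0" using that by (auto simp: f'_def)
      then show ?thesis using supp cobd_supported[OF up g(1)] by blast
    qed
    have supph: "F \<in> \<Delta>" if "h F \<noteq> 0" for F
    proof -
      have F: "rk F = r" "v r \<notin> F" "f' (insert (v r) F) \<noteq> 0"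
        using that by (auto simp: h_def split: if_splits)
      then have "insert (v r) F - {v r} \<in> \<Delta>"
        using down[OF supp'[OF F(3)]] rk(1)[of F] by simp
      then show ?thesis using F(2) by simp
    qed
    have low: "cobd h F = 0" if "rk F < r" for F
    proof -
      have "rk (F - {j}) \<noteq> r" for j using mono[of "F - {j}" F] that by auto
      then show ?thesis by (simp add: cobd_def h_def)
    qed
    have piv: "cobd h F = f' F" if "rk F = r" "v r \<in> F" for F
    proof -
      have "cobd h F = (\<Sum>j\<in>{v r}. cech_sign j F * h (F - {j}))"
        unfolding cobd_def by (rule sum.mono_neutral_right) (use that in \<open>auto simp: h_def\<close>)
      also have "\<dots> = f' F" using that rk(2)[of F] by (simp add: h_def insert_absorb)
      finally show ?thesis .
    qed
    have zero: "f' F - cobd h F = 0" if "card F = p" "rk F < r \<or> rk F = r \<and> v r \<in> F" for F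
      using that g(2)[of F] low[of F] piv[of F] by (auto simp: f'_def)
    \<comment> \<open>The cocycle condition at \<open>insert (v r) F\<close>: all its terms but the one of \<open>F\<close> vanish already.\<close>
    have nopiv: "f' F - cobd h F = 0" if F: "card F = p" "rk F = r" "v r \<notin> F" for F
    proof -
      let ?F = "insert (v r) F" and ?f = "\<lambda>F. f' F - cobd h F"
      have c: "card ?F = Suc p" using F by simp
      have "0 = cobd ?f ?F" using c cyc by (simp add: cobd_diff f'_def cobd_cobd)
      also have "\<dots> = (\<Sum>j\<in>{v r}. cech_sign j ?F * ?f (?F - {j}))"
        unfolding cobd_def[of ?f]
      proof (rule sum.mono_neutral_right; (intro ballI)?)
        fix j assume j: "j \<in> ?F - {v r}"
        have "rk (?F - {j}) \<le> r" using mono[of "?F - {j}" ?F] rk(1)[of F] F by simp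
        moreover have "card (?F - {j}) = p" using c j by (simp add: card_Diff_singleton_if)
        ultimately have "?f (?F - {j}) = 0" using j by (intro zero) auto
        then show "cech_sign j ?F * ?f (?F - {j}) = 0" by (simp only: mult_zero_right)
      qed auto
      also have "\<dots> = cech_sign (v r) ?F * ?f F" using F by simp
      finally have "cech_sign (v r) ?F * (cech_sign (v r) ?F * ?f F) = 0" by (simp only: mult_zero_right)
      then show ?thesis by (simp only: cech_sign_square)
    qed
    show ?case
    proof (intro exI[of _ "\<lambda>F. g F + h F"] conjI allI impI)
      fix F assume F: "card F = p" "rk F < Suc r"
      then have "f' F - cobd h F = 0" using zero[of F] nopiv[of F] by linarith
      then show "f F = cobd (\<lambda>F. g F + h F) F" by (simp add: f'_def cobd_add algebra_simps)
    next
      fix F assume "g F + h F \<noteq> 0"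
      then have "g F \<noteq> 0 \<or> h F \<noteq> 0" by auto
      then show "F \<in> \<Delta>" using g(1) supph by blast
    qed
  qed
  from this[of "Suc (rk UNIV)"]
  show "\<exists>g. (\<forall>F. g F \<noteq> 0 \<longrightarrow> F \<in> \<Delta>) \<and> (\<forall>F. card F = p \<longrightarrow> f F = cobd g F)"
    using mono[OF subset_UNIV] by (simp add: less_Suc_eq_le)
qed

lemma exact_at_cone:
  fixes \<Delta> :: "'n::{finite,linorder} set set"
  assumes "up_closed \<Delta>" and "\<And>F. F \<in> \<Delta> \<Longrightarrow> F - {j} \<in> \<Delta>"
  shows "exact_at (K :: 'k::comm_ring_1 itself) \<Delta> p"
  by (rule exact_at_matching[of \<Delta> "\<lambda>_. j" "\<lambda>_. 0"])
    (fact assms(1), erule assms(2), simp_all)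

text \<open>
  Exactness in position \<open>p\<close> is inherited by a subfamily that has the same sets of cardinality
  \<open>p - 1\<close>: a primitive in the larger family is supported there.
\<close>

lemma exact_at_subset:
  fixes \<Delta> \<Delta>' :: "'n::{finite,linorder} set set"
  assumes ex: "exact_at (K :: 'k::comm_ring_1 itself) \<Delta>' p" and sub: "\<Delta> \<subseteq> \<Delta>'"
    and eq: "\<And>F. F \<in> \<Delta>' \<Longrightarrow> Suc (card F) = p \<Longrightarrow> F \<in> \<Delta>"
  shows "exact_at K \<Delta> p"
  unfolding exact_at_def
proof (intro allI impI)
  fix f :: "'n set \<Rightarrow> 'k"
  assume f: "\<forall>F. f F \<noteq> 0 \<longrightarrow> F \<in> \<Delta>" "\<forall>F. card F = Suc p \<longrightarrow> cobd f F = 0"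
  obtain g where g: "\<And>F. g F \<noteq> 0 \<Longrightarrow> F \<in> \<Delta>'" "\<And>F. card F = p \<Longrightarrow> f F = cobd g F"
    using ex f sub unfolding exact_at_def by blast
  define g' where "g' = (\<lambda>F. if F \<in> \<Delta> then g F else 0)"
  have "cobd g' F = cobd g F" if "card F = p" for F
  proof -
    have "g' (F - {j}) = g (F - {j})" if j: "j \<in> F" for j
    proof -
      have "Suc (card (F - {j})) = p"
        using card_Suc_Diff1[of F j] j \<open>card F = p\<close> finite[of F] by simp
      then show ?thesis using g(1)[of "F - {j}"] eq[of "F - {j}"] by (auto simp: g'_def)
    qed
    then show ?thesis unfolding cobd_def by (auto intro: sum.cong)
  qed
  then show "\<exists>g. (\<forall>F. g F \<noteq> 0 \<longrightarrow> F \<in> \<Delta>) \<and> (\<forall>F. card F = p \<longrightarrow> f F = cobd g F)"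
    using g(2) by (intro exI[of _ g']) (auto simp: g'_def)
qed

section \<open>A complex with the homology of the boundary of a simplex\<close>

lemma cech_sign_compl:
  fixes \<sigma> :: "'n::{finite,linorder} set"
  shows "cech_sign j (- \<sigma>) = cech_sign j UNIV * (\<Prod>i\<in>\<sigma>. if i < j then - 1 else (1 :: 'k::comm_ring_1))"
proof -
  let ?q = "\<lambda>i. if i < j then - 1 else (1 :: 'k)"
  have "(\<Prod>i\<in>UNIV. ?q i) = (\<Prod>i\<in>- \<sigma>. ?q i) * (\<Prod>i\<in>\<sigma>. ?q i)"
    using prod.subset_diff[of \<sigma> UNIV ?q] by (simp add: Compl_eq_Diff_UNIV)
  moreover have "(\<Prod>i\<in>\<sigma>. ?q i) * (\<Prod>i\<in>\<sigma>. ?q i) = 1"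
    unfolding prod.distrib[symmetric] by (rule prod.neutral) simp
  ultimately show ?thesis by (simp add: cech_sign_prod mult.assoc)
qed

text \<open>
  The sign of the map \<open>gr\<close> on \<open>\<sigma>\<close>, that is \<open>-1\<close> to the number of inversions, when \<open>gr\<close> is
  injective on \<open>\<sigma>\<close>. As a product over all pairs it can be compared factor by factor when one
  element is replaced by another.
\<close>

definition inversion_sign :: "('n::linorder \<Rightarrow> nat) \<Rightarrow> 'n set \<Rightarrow> 'k::comm_ring_1" where
  "inversion_sign gr \<sigma> = (\<Prod>a\<in>\<sigma>. \<Prod>b\<in>\<sigma>. if gr b < gr a \<and> a < b then - 1 else 1)"

lemma inversion_sign_insert:
  assumes "finite \<rho>" "a \<notin> \<rho>"
  shows "inversion_sign gr (insert a \<rho>) = inversion_sign gr \<rho> *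
    (\<Prod>c\<in>\<rho>. (if gr a < gr c \<and> c < a then - 1 else 1) * (if gr c < gr a \<and> a < c then - 1 else 1))"
  using assms by (simp add: inversion_sign_def prod.distrib mult_ac)

text \<open>
  Let \<open>a\<close> and \<open>b\<close> have the same group. The set \<open>\<rho> \<union> {a, b}\<close> is reached from \<open>\<rho> \<union> {a}\<close> by adding
  \<open>b\<close> and from \<open>\<rho> \<union> {b}\<close> by adding \<open>a\<close>; with the signs below the two contributions to a boundary
  cancel. Every \<open>c\<close> in \<open>\<rho>\<close> contributes the same sign on both sides, so only the order of \<open>a\<close> and
  \<open>b\<close> counts.
\<close>

lemma inversion_sign_exchange:
  fixes \<rho> :: "'n::{finite,linorder} set"
  assumes ab: "a < b" "gr a = gr b" and \<rho>: "\<And>c. c \<in> \<rho> \<Longrightarrow> gr c \<noteq> gr b"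
  shows "inversion_sign gr (insert a \<rho>) * (\<Prod>i\<in>insert a \<rho>. cech_sign i UNIV) * cech_sign b (- insert a \<rho>) =
    - (inversion_sign gr (insert b \<rho>) * (\<Prod>i\<in>insert b \<rho>. cech_sign i UNIV) *
       (cech_sign a (- insert b \<rho>) :: 'k::comm_ring_1))"
proof -
  have notin: "a \<notin> \<rho>" "b \<notin> \<rho>" using \<rho> ab by auto
  define P where "P = (\<lambda>a b. \<Prod>c\<in>\<rho>. (if gr a < gr c \<and> c < a then - 1 else 1) *
    (if gr c < gr a \<and> a < c then - 1 else 1) * (if c < b then - 1 else (1 :: 'k)))"
  have P: "P a b = P b a" unfolding P_def
  proof (rule prod.cong[OF refl])
    fix c assume c: "c \<in> \<rho>"
    then have "c \<noteq> a" "c \<noteq> b" "gr c \<noteq> gr b" using notin \<rho> by auto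
    then show "(if gr a < gr c \<and> c < a then - 1 else 1) * (if gr c < gr a \<and> a < c then - 1 else 1) *
        (if c < b then - 1 else (1 :: 'k)) =
      (if gr b < gr c \<and> c < b then - 1 else 1) * (if gr c < gr b \<and> b < c then - 1 else 1) *
        (if c < a then - 1 else 1)"
      using ab by auto
  qed
  have expand: "inversion_sign gr (insert x \<rho>) * (\<Prod>i\<in>insert x \<rho>. cech_sign i UNIV) * cech_sign y (- insert x \<rho>) =
    inversion_sign gr \<rho> * (\<Prod>i\<in>\<rho>. cech_sign i UNIV) * cech_sign x UNIV * cech_sign y UNIV * P x y *
      (if x < y then - 1 else (1 :: 'k))" if "x \<notin> \<rho>" for x y
    using that unfolding cech_sign_compl
    by (simp add: inversion_sign_insert P_def prod.distrib mult_ac)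
  show ?thesis
    unfolding expand[OF notin(1)] expand[OF notin(2)] P using ab less_not_sym[OF ab(1)] by (simp add: mult_ac)
qed

text \<open>
  Passing to complements, this is the simplicial chain complex of the sets of elements of
  nonzero group that miss a whole group. It is a union of \<open>s\<close> simplices with the homology of the
  boundary of the simplex on \<open>{1..s}\<close>. A cycle that is not a boundary is the boundary of a
  transversal \<open>\<tau>\<close>, a set with one element of each group; in terms of cochains, the coboundary of
  the indicator \<open>w0\<close> of \<open>- \<tau>\<close>. If it were the coboundary of some \<open>g\<close> supported on the family,
  the difference \<open>w\<close> would be a cycle in which \<open>\<tau>\<close> is the only transversal with a nonzero
  coefficient. But the simplicial map that sends an element to its group maps \<open>w\<close> to a
  top-dimensional cycle of the full simplex on \<open>{1..s}\<close>, which is zero. Concretely, \<open>0\<close> is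
  written as the signed sum of the cocycle conditions over all transversals \<open>\<sigma>\<close> of the groups
  \<open>1, \<dots>, s - 1\<close>, in which everything cancels but \<open>w (- \<tau>)\<close>.
\<close>

lemma not_exact_at_missing_group:
  fixes gr :: "'n::{finite,linorder} \<Rightarrow> nat"
  assumes s: "s \<ge> 1" and le: "\<And>v. gr v \<le> s" and ne: "\<And>i. i \<in> {1..s} \<Longrightarrow> \<exists>v. gr v = i"
    and p: "p + s = Suc (card (UNIV :: 'n set))"
  shows "\<not> exact_at (K :: 'k::field itself)
    {F. {v. gr v = 0} \<subseteq> F \<and> (\<exists>i\<in>{1..s}. {v. gr v = i} \<subseteq> F)} p" (is "\<not> exact_at K ?\<Delta> p")
proof
  assume exact: "exact_at K ?\<Delta> p"
  obtain x where x: "\<And>i. i \<in> {1..s} \<Longrightarrow> gr (x i) = i" using ne by metis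
  define \<tau> where "\<tau> = x ` {1..s}"
  have in\<tau>: "v = x (gr v) \<and> gr v \<in> {1..s}" if "v \<in> \<tau>" for v using that x by (auto simp: \<tau>_def)
  define w0 where "w0 = (\<lambda>F. if F = - \<tau> then 1 else (0 :: 'k))"
  have supp: "F \<in> ?\<Delta>" if "cobd w0 F \<noteq> 0" for F
  proof -
    have "\<exists>j\<in>F. w0 (F - {j}) \<noteq> 0"
    proof (rule ccontr)
      assume "\<not> (\<exists>j\<in>F. w0 (F - {j}) \<noteq> 0)"
      then have "cobd w0 F = 0" by (simp add: cobd_def)
      then show False using that by contradiction
    qed
    then obtain j where j: "j \<in> F" "F - {j} = - \<tau>" by (auto simp: w0_def split: if_splits)
    then have "j \<in> \<tau>" and F: "F = insert j (- \<tau>)" by auto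
    then have j': "j = x (gr j)" "gr j \<in> {1..s}" using in\<tau> by auto
    have "{v. gr v = gr j} \<subseteq> F" using in\<tau> j' unfolding F by auto metis
    moreover have "{v. gr v = 0} \<subseteq> F" using in\<tau> unfolding F by fastforce
    ultimately show ?thesis using j'(2) by auto
  qed
  obtain g where g: "\<And>F. g F \<noteq> 0 \<Longrightarrow> F \<in> ?\<Delta>" "\<And>F. card F = p \<Longrightarrow> cobd w0 F = cobd g F"
    using exact[unfolded exact_at_def, rule_format, of "cobd w0"] supp by (auto simp: cobd_cobd)
  define w where "w = (\<lambda>F. w0 F - g F)"
  have w_cyc: "cobd w F = 0" if "card F = p" for F
    using g(2)[OF that] by (simp add: w_def cobd_diff)
  have w_zero: "w F = 0" if "gr v = 0" "v \<notin> F" for v F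
  proof -
    have "v \<in> - \<tau>" using in\<tau> that by fastforce
    then have "w0 F = 0" using that by (auto simp: w0_def)
    moreover have "g F = 0" using g(1)[of F] that by blast
    ultimately show ?thesis by (simp add: w_def)
  qed
  have w_trans: "w (- \<sigma>) = (if \<sigma> = \<tau> then 1 else 0)" if tr: "\<And>i. i \<in> {1..s} \<Longrightarrow> \<exists>v\<in>\<sigma>. gr v = i" for \<sigma>
  proof -
    have "\<not> {v. gr v = i} \<subseteq> - \<sigma>" if "i \<in> {1..s}" for i using tr[OF that] by auto
    then have "- \<sigma> \<notin> ?\<Delta>" by blast
    then have "g (- \<sigma>) = 0" using g(1) by blast
    then show ?thesis by (auto simp: w_def w0_def)
  qed
  define T where "T = {\<sigma>. inj_on gr \<sigma> \<and> gr ` \<sigma> = {1..<s}}"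
  define c where "c = (\<lambda>\<sigma>. inversion_sign gr \<sigma> * (\<Prod>i\<in>\<sigma>. cech_sign i UNIV) :: 'k)"
  define t where "t = (\<lambda>(\<sigma>, j). c \<sigma> * (cech_sign j (- \<sigma>) * w (- \<sigma> - {j})))"
  have cardT: "card (- \<sigma>) = p" if "\<sigma> \<in> T" for \<sigma>
  proof -
    have "inj_on gr \<sigma>" "gr ` \<sigma> = {1..<s}" using that by (auto simp: T_def)
    then have "card \<sigma> = s - 1" using card_image[of gr \<sigma>] by simp
    then show ?thesis using p s by (simp add: Compl_eq_Diff_UNIV card_Diff_subset)
  qed
  \<comment> \<open>The pairs \<open>(\<sigma>, j)\<close>, sorted by the group of the new element \<open>j\<close>: group \<open>0\<close> leaves the
    support of \<open>w\<close>, group \<open>s\<close> completes a transversal, the other groups cancel in pairs.\<close>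
  define S where "S = (\<lambda>A. {(\<sigma>, j). \<sigma> \<in> T \<and> j \<notin> \<sigma> \<and> gr j \<in> A})"
  have "0 = (\<Sum>\<sigma>\<in>T. c \<sigma> * cobd w (- \<sigma>))" using w_cyc cardT by simp
  also have "\<dots> = (\<Sum>\<sigma>\<in>T. \<Sum>j\<in>- \<sigma>. t (\<sigma>, j))" by (simp add: cobd_def t_def sum_distrib_left)
  also have "\<dots> = (\<Sum>q\<in>Sigma T (\<lambda>\<sigma>. - \<sigma>). t q)" by (simp add: sum.Sigma)
  also have "Sigma T (\<lambda>\<sigma>. - \<sigma>) = S {0} \<union> (S {s} \<union> S {1..<s})"
    using le s unfolding S_def by (auto simp: le_less Suc_le_eq)
  also have "(\<Sum>q\<in>\<dots>. t q) = (\<Sum>q\<in>S {0}. t q) + ((\<Sum>q\<in>S {s}. t q) + (\<Sum>q\<in>S {1..<s}. t q))"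
    using s by (subst sum.union_disjoint sum.union_disjoint; (simp add: finite)?; auto simp: S_def)+
  also have "(\<Sum>q\<in>S {0}. t q) = 0"
    by (rule sum.neutral) (auto simp: S_def t_def w_zero)
  also have "(\<Sum>q\<in>S {s}. t q) = t (\<tau> - {x s}, x s)"
  proof -
    have sub: "\<tau> - {x s} \<in> T"
    proof -
      have "inj_on gr \<tau>" using x by (auto simp: \<tau>_def inj_on_def)
      moreover have "gr ` (\<tau> - {x s}) = {1..<s}"
      proof
        show "gr ` (\<tau> - {x s}) \<subseteq> {1..<s}" using in\<tau> by (fastforce simp: le_less)
        show "{1..<s} \<subseteq> gr ` (\<tau> - {x s})"
        proof
          fix i assume i: "i \<in> {1..<s}"
          then have "gr (x i) = i" "gr (x s) = s" using x s by auto
          then have "x i \<in> \<tau> - {x s}" "i = gr (x i)" using i by (auto simp: \<tau>_def)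
          then show "i \<in> gr ` (\<tau> - {x s})" by (rule rev_image_eqI)
        qed
      qed
      ultimately show ?thesis by (auto simp: T_def intro: inj_on_subset)
    qed
    have "(\<Sum>q\<in>S {s}. t q) = (\<Sum>q\<in>{(\<tau> - {x s}, x s)}. t q)"
    proof (rule sum.mono_neutral_right; (intro ballI)?)
      show "{(\<tau> - {x s}, x s)} \<subseteq> S {s}" using sub x s by (auto simp: S_def)
      fix q assume "q \<in> S {s} - {(\<tau> - {x s}, x s)}"
      then obtain \<sigma> j where q: "q = (\<sigma>, j)" "\<sigma> \<in> T" "j \<notin> \<sigma>" "gr j = s" "(\<sigma>, j) \<noteq> (\<tau> - {x s}, x s)"
        by (auto simp: S_def)
      have "\<exists>v\<in>insert j \<sigma>. gr v = i" if "i \<in> {1..s}" for i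
      proof (cases "i = s")
        case False
        then have "i \<in> gr ` \<sigma>" using q(2) that by (simp add: T_def)
        then show ?thesis by auto
      qed (use q in auto)
      moreover have "insert j \<sigma> \<noteq> \<tau>"
      proof
        assume e: "insert j \<sigma> = \<tau>"
        then have "j = x s" using in\<tau>[of j] q by auto
        then show False using e q by auto
      qed
      ultimately have "w (- insert j \<sigma>) = 0" using w_trans[of "insert j \<sigma>"] by auto
      moreover have "- \<sigma> - {j} = - insert j \<sigma>" by auto
      ultimately show "t q = 0" by (simp add: q t_def)
    qed simp
    then show ?thesis by simp
  qed
  also have "(\<Sum>q\<in>S {1..<s}. t q) = 0"
  proof -
    \<comment> \<open>A pair \<open>(\<sigma>, j)\<close> with \<open>j\<close> in a group already met by \<open>\<sigma>\<close> is \<open>(insert a \<rho>, b)\<close> with \<open>a\<close>, \<open>b\<close> of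
      the same group; exchanging \<open>a\<close> and \<open>b\<close> is the cancelling involution.\<close>
    define R where "R = {(\<rho>, a, b). a \<noteq> b \<and> gr a = gr b \<and> a \<notin> \<rho> \<and> insert a \<rho> \<in> T}"
    define \<phi> where "\<phi> = (\<lambda>(\<rho>, a, b). (insert a \<rho> :: 'n set, b :: 'n))"
    let ?L = "{(\<rho>, a, b). (\<rho>, a, b) \<in> R \<and> a < b}" and ?G = "{(\<rho>, a, b). (\<rho>, a, b) \<in> R \<and> b < a}"
    have R: "b \<notin> \<rho> \<and> (\<rho>, b, a) \<in> R \<and> (\<forall>c\<in>\<rho>. gr c \<noteq> gr b)" if "(\<rho>, a, b) \<in> R" for \<rho> a b
    proof -
      have r: "a \<noteq> b" "gr a = gr b" "a \<notin> \<rho>" "inj_on gr (insert a \<rho>)" "gr ` insert a \<rho> = {1..<s}"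
        using that by (auto simp: R_def T_def)
      have c: "\<forall>c\<in>\<rho>. gr c \<noteq> gr b" using r by (auto simp: inj_on_def)
      then have b: "b \<notin> \<rho>" by auto
      have "inj_on gr (insert b \<rho>)" using r(4) c by (auto simp: inj_on_def)
      moreover have "gr ` insert b \<rho> = {1..<s}" using r by simp
      ultimately show ?thesis using r b c by (auto simp: R_def T_def)
    qed
    have img: "S {1..<s} = \<phi> ` R"
    proof (intro equalityI subsetI)
      fix q assume "q \<in> S {1..<s}"
      then obtain \<sigma> j where q: "q = (\<sigma>, j)" "\<sigma> \<in> T" "j \<notin> \<sigma>" "gr j \<in> {1..<s}" by (auto simp: S_def)
      then obtain a where a: "a \<in> \<sigma>" "gr a = gr j" by (auto simp: T_def) (metis imageE atLeastLessThan_iff Suc_leI q(4))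
      have "(\<sigma> - {a}, a, j) \<in> R" using q a by (auto simp: R_def insert_absorb)
      moreover have "q = \<phi> (\<sigma> - {a}, a, j)" using q a by (auto simp: \<phi>_def)
      ultimately show "q \<in> \<phi> ` R" by (rule rev_image_eqI)
    next
      fix q assume "q \<in> \<phi> ` R"
      then obtain \<rho> a b where q: "(\<rho>, a, b) \<in> R" "q = (insert a \<rho>, b)" by (auto simp: \<phi>_def)
      then have "insert a \<rho> \<in> T" "gr b = gr a" "a \<noteq> b" by (auto simp: R_def)
      moreover from this have "gr b \<in> {1..<s}" by (auto simp: T_def)
      ultimately show "q \<in> S {1..<s}" using R[OF q(1)] q(2) by (auto simp: S_def)
    qed
    have inj: "inj_on \<phi> R"
    proof (rule inj_onI)
      fix y z assume "y \<in> R" "z \<in> R" "\<phi> y = \<phi> z"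
      moreover obtain \<rho> a b \<rho>' a' b' where yz: "y = (\<rho>, a, b)" "z = (\<rho>', a', b')" by (metis prod_cases3)
      ultimately have "insert a \<rho> = insert a' \<rho>'" "b = b'" "gr a = gr a'" "inj_on gr (insert a \<rho>)"
        "a \<notin> \<rho>" "a' \<notin> \<rho>'"
        by (auto simp: R_def \<phi>_def T_def)
      moreover from this have "a = a'" by (metis inj_onD insertI1)
      ultimately show "y = z" unfolding yz by auto
    qed
    have swap: "t (\<phi> (\<rho>, b, a)) = - t (\<phi> (\<rho>, a, b))" if "(\<rho>, a, b) \<in> R" "a < b" for \<rho> a b
    proof -
      have e: "- insert b \<rho> - {a} = - insert a \<rho> - {b}" by auto
      have "c (insert a \<rho>) * cech_sign b (- insert a \<rho>) = - (c (insert b \<rho>) * cech_sign a (- insert b \<rho>))"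
        unfolding c_def by (rule inversion_sign_exchange) (use that R[OF that(1)] in \<open>auto simp: R_def\<close>)
      then show ?thesis
        unfolding t_def \<phi>_def prod.case e mult.assoc[symmetric] by simp
    qed
    have "(\<Sum>q\<in>S {1..<s}. t q) = (\<Sum>r\<in>R. t (\<phi> r))"
      unfolding img by (simp add: sum.reindex[OF inj])
    also have "R = ?L \<union> ?G" by (auto simp: R_def)
    also have "(\<Sum>r\<in>?L \<union> ?G. t (\<phi> r)) = (\<Sum>r\<in>?L. t (\<phi> r)) + (\<Sum>r\<in>?G. t (\<phi> r))"
      by (rule sum.union_disjoint) auto
    also have "(\<Sum>r\<in>?G. t (\<phi> r)) = (\<Sum>r\<in>?L. - t (\<phi> r))"
      by (rule sum.reindex_bij_witness[of _ "\<lambda>(\<rho>, a, b). (\<rho>, b, a)" "\<lambda>(\<rho>, a, b). (\<rho>, b, a)"])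
        (auto dest: R simp: swap)
    finally show ?thesis by (simp add: sum_negf)
  qed
  finally have "t (\<tau> - {x s}, x s) = 0" by simp
  moreover have "- (\<tau> - {x s}) - {x s} = - \<tau>" using s by (auto simp: \<tau>_def)
  moreover have "w (- \<tau>) = 1" using w_trans[of \<tau>] x by (auto simp: \<tau>_def)
  moreover have "c \<sigma> \<noteq> 0" "cech_sign j \<sigma> \<noteq> (0 :: 'k)" for j \<sigma>
    by (auto simp: c_def cech_sign_def inversion_sign_def)
  ultimately show False by (simp add: t_def)
qed

section \<open>Local cohomology of monomial ideals by multidegree\<close>

definition expo :: "('n::finite \<Rightarrow> int) \<Rightarrow> 'n \<Rightarrow>\<^sub>0 nat" where
  "expo \<beta> = Abs_poly_mapping (\<lambda>j. nat (\<beta> j))"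

text \<open>
  Coefficients are indexed by integer vectors and vanish outside the nonnegative orthant. With
  this convention multiplication by a monomial is a translation without case distinctions, and
  the coefficient of \<open>x\<^sup>\<alpha>\<close> in the fraction \<open>m / x\<^sub>F ^ k\<close> is the coefficient of \<open>m\<close> at
  \<open>shift k F \<alpha>\<close>.
\<close>

definition zcoeff :: "('n::finite, 'k::comm_ring_1) mpoly \<Rightarrow> ('n \<Rightarrow> int) \<Rightarrow> 'k" where
  "zcoeff m \<beta> = (if \<forall>j. 0 \<le> \<beta> j then Poly_Mapping.lookup m (expo \<beta>) else 0)"

definition shift :: "int \<Rightarrow> 'n set \<Rightarrow> ('n \<Rightarrow> int) \<Rightarrow> 'n \<Rightarrow> int" where
  "shift k F \<alpha> = (\<lambda>j. \<alpha> j + (if j \<in> F then k else 0))"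

lemma lookup_expo [simp]: "Poly_Mapping.lookup (expo \<beta>) j = nat (\<beta> j)"
  by (simp add: expo_def)

lemma expo_lookup [simp]: "expo (\<lambda>j. int (Poly_Mapping.lookup e j)) = e"
  by (rule poly_mapping_eqI) simp

lemma expo_inj: "\<lbrakk>expo \<beta> = expo \<gamma>; \<forall>j. 0 \<le> \<beta> j; \<forall>j. 0 \<le> \<gamma> j\<rbrakk> \<Longrightarrow> \<beta> = \<gamma>"
  by (metis lookup_expo eq_nat_nat_iff ext)

lemma shift_shift [simp]: "shift a F (shift b F \<alpha>) = shift (a + b) F \<alpha>"
  by (auto simp: shift_def)

lemma shift_0 [simp]: "shift 0 F \<alpha> = \<alpha>"
  by (auto simp: shift_def)

lemma sum_shift: "(\<Sum>j\<in>UNIV. shift k F \<alpha> j) = (\<Sum>j\<in>UNIV. \<alpha> j) + k * int (card (F :: 'n::finite set))"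
  by (simp add: shift_def sum.distrib sum.If_cases)

lemma mono_deg_expo: "\<forall>j. 0 \<le> \<beta> j \<Longrightarrow> int (mono_deg (expo \<beta>)) = (\<Sum>j\<in>UNIV. \<beta> j)"
  by (simp add: mono_deg_def)

lemma poly_mapping_eq_sum_single:
  "m = (\<Sum>b\<in>Poly_Mapping.keys m. Poly_Mapping.single b (Poly_Mapping.lookup m b))"
  by (rule poly_mapping_eqI) (simp add: lookup_sum lookup_single when_def in_keys_iff)

lemma lookup_single_mult:
  fixes a :: "'n::finite \<Rightarrow>\<^sub>0 nat" and c :: "'k::comm_ring_1"
  shows "Poly_Mapping.lookup (Poly_Mapping.single a c * m) e =
    (if \<forall>j. Poly_Mapping.lookup a j \<le> Poly_Mapping.lookup e j
     then c * Poly_Mapping.lookup m (e - a) else 0)"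
proof -
  have eq: "a + b = e \<longleftrightarrow> (\<forall>j. Poly_Mapping.lookup a j \<le> Poly_Mapping.lookup e j) \<and> b = e - a" for b
    by (auto simp: poly_mapping_eq_iff fun_eq_iff lookup_add lookup_minus)
      (metis le_add1, metis add_diff_cancel_left')
  have "Poly_Mapping.single a c * m =
      (\<Sum>b\<in>Poly_Mapping.keys m. Poly_Mapping.single (a + b) (c * Poly_Mapping.lookup m b))"
    by (subst poly_mapping_eq_sum_single[of m]) (simp add: sum_distrib_left mult_single)
  then have sum: "Poly_Mapping.lookup (Poly_Mapping.single a c * m) e =
      (\<Sum>b\<in>Poly_Mapping.keys m. if a + b = e then c * Poly_Mapping.lookup m b else 0)"
    by (simp add: lookup_sum lookup_single when_def)
  show ?thesis
  proof (cases "\<forall>j. Poly_Mapping.lookup a j \<le> Poly_Mapping.lookup e j")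
    case True
    then have "a + b = e \<longleftrightarrow> b = e - a" for b using eq[of b] by blast
    then show ?thesis using True by (simp add: sum in_keys_iff)
  next
    case False
    then have "a + b \<noteq> e" for b using eq[of b] by blast
    then show ?thesis unfolding if_not_P[OF False] by (simp add: sum)
  qed
qed

lemma zcoeff_ext: "(\<And>\<beta>. zcoeff f \<beta> = zcoeff g \<beta>) \<Longrightarrow> f = g"
proof (rule poly_mapping_eqI)
  fix e assume "\<And>\<beta>. zcoeff f \<beta> = zcoeff g \<beta>"
  from this[of "\<lambda>j. int (Poly_Mapping.lookup e j)"]
  show "Poly_Mapping.lookup f e = Poly_Mapping.lookup g e" by (simp add: zcoeff_def)
qed

lemma zcoeff_0 [simp]: "zcoeff 0 \<beta> = 0"
  and zcoeff_diff [simp]: "zcoeff (f - g) \<beta> = zcoeff f \<beta> - zcoeff g \<beta>"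
  and zcoeff_minus [simp]: "zcoeff (- f) \<beta> = - zcoeff f \<beta>"
  by (simp_all add: zcoeff_def lookup_minus)

lemma zcoeff_sum [simp]: "zcoeff (\<Sum>i\<in>A. h i) \<beta> = (\<Sum>i\<in>A. zcoeff (h i) \<beta>)"
proof (cases "\<forall>j. 0 \<le> \<beta> j")
  case False
  show ?thesis unfolding zcoeff_def if_not_P[OF False] by simp
qed (simp add: zcoeff_def lookup_sum)

lemma zcoeff_single:
  "\<forall>j. 0 \<le> \<gamma> j \<Longrightarrow> zcoeff (Poly_Mapping.single (expo \<gamma>) c) \<beta> = (if \<beta> = \<gamma> then c else 0)"
  using expo_inj by (auto simp: zcoeff_def lookup_single when_def)

lemma zcoeff_single_mult:
  "zcoeff (Poly_Mapping.single a c * m) \<beta> = c * zcoeff m (\<lambda>j. \<beta> j - int (Poly_Mapping.lookup a j))"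
proof (cases "\<forall>j. 0 \<le> \<beta> j")
  case True
  have "expo \<beta> - a = expo (\<lambda>j. \<beta> j - int (Poly_Mapping.lookup a j))"
    by (rule poly_mapping_eqI) (simp add: lookup_minus nat_diff_distrib')
  moreover have "(Poly_Mapping.lookup a j \<le> nat (\<beta> j)) = (int (Poly_Mapping.lookup a j) \<le> \<beta> j)" for j
    using True[rule_format, of j] by linarith
  ultimately show ?thesis using True by (simp add: zcoeff_def lookup_single_mult)
next
  case False
  then obtain j where "\<not> 0 \<le> \<beta> j" by blast
  then have "\<not> 0 \<le> \<beta> j - int (Poly_Mapping.lookup a j)" by simp
  then have "\<not> (\<forall>j. 0 \<le> \<beta> j - int (Poly_Mapping.lookup a j))" by blast
  then show ?thesis unfolding zcoeff_def if_not_P[OF False] by (simp only: if_False mult_zero_right)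
qed

lemma zcoeff_sign: "zcoeff ((- 1) ^ n * f) \<beta> = (- 1) ^ n * zcoeff f \<beta>"
  by (cases "even n") simp_all

lemma single_power:
  "Poly_Mapping.single (e :: 'n \<Rightarrow>\<^sub>0 nat) (1 :: 'k::comm_ring_1) ^ k =
    Poly_Mapping.single (\<Sum>i<k. e) 1"
  by (induction k) (simp_all add: mult_single single_one[symmetric] add.commute del: single_one sum_constant)

lemma single_prod:
  "(\<Prod>i\<in>A. Poly_Mapping.single (e i :: 'n \<Rightarrow>\<^sub>0 nat) (1 :: 'k::comm_ring_1)) =
    Poly_Mapping.single (\<Sum>i\<in>A. e i) 1"
  by (induction A rule: infinite_finite_induct)
    (simp_all add: mult_single single_one[symmetric] del: single_one)

lemma zcoeff_Var_power_mult:
  assumes "j \<in> F"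
  shows "zcoeff (Var j ^ k * m) (shift (int k) F \<alpha>) = zcoeff m (shift (int k) (F - {j}) \<alpha>)"
proof -
  have "(\<lambda>i. shift (int k) F \<alpha> i - int (\<Sum>i'<k. Poly_Mapping.lookup (Poly_Mapping.single j 1) i)) =
      shift (int k) (F - {j}) \<alpha>"
    using assms by (auto simp: shift_def lookup_single when_def)
  then show ?thesis
    by (simp add: Var_def single_power zcoeff_single_mult lookup_sum del: sum_constant)
qed

lemma subspace_keys:
  fixes E :: "('n::finite \<Rightarrow>\<^sub>0 nat) set"
  assumes E_up: "\<And>e e'. \<lbrakk>e \<in> E; \<And>j. Poly_Mapping.lookup e j \<le> Poly_Mapping.lookup e' j\<rbrakk> \<Longrightarrow> e' \<in> E"
  shows "module.subspace (*) {f :: ('n, 'k::comm_ring_1) mpoly. Poly_Mapping.keys f \<subseteq> E}"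
proof -
  interpret M: module "(*) :: ('n, 'k) mpoly \<Rightarrow> ('n, 'k) mpoly \<Rightarrow> ('n, 'k) mpoly"
    by (rule module_mult)
  show ?thesis
  proof (rule M.subspaceI)
    fix x y c :: "('n, 'k) mpoly"
    assume x: "x \<in> {f. Poly_Mapping.keys f \<subseteq> E}"
    have "a + b \<in> E" if "b \<in> E" for a b :: "'n \<Rightarrow>\<^sub>0 nat"
      using that by (rule E_up) (simp add: lookup_add)
    then show "c * x \<in> {f. Poly_Mapping.keys f \<subseteq> E}" using x keys_mult[of c x] by fastforce
    assume "y \<in> {f. Poly_Mapping.keys f \<subseteq> E}"
    then show "x + y \<in> {f. Poly_Mapping.keys f \<subseteq> E}" using x Poly_Mapping.keys_add[of x y] by auto
  qed simp
qed

text \<open>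
  The monomial ideals are the sets of polynomials with exponents in an up-closed set \<open>E\<close>. The Cech
  complex of such an ideal is graded by \<open>\<alpha> :: 'n \<Rightarrow> int\<close>, and its part of multidegree \<open>\<alpha>\<close> is a
  complex of the kind studied above, for the sets \<open>F\<close> such that \<open>x\<^sup>\<alpha>\<close> lies in the localization at
  the variables in \<open>F\<close>.
\<close>

locale monomial_ideal =
  fixes E :: "('n::{finite,linorder} \<Rightarrow>\<^sub>0 nat) set" and J :: "('n, 'k::field) mpoly set"
  assumes J_eq: "J = {f. Poly_Mapping.keys f \<subseteq> E}"
    and E_up: "\<lbrakk>e \<in> E; \<And>j. Poly_Mapping.lookup e j \<le> Poly_Mapping.lookup e' j\<rbrakk> \<Longrightarrow> e' \<in> E"
begin

lemma subspace_J: "module.subspace (*) J"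
  unfolding J_eq by (rule subspace_keys) (rule E_up)

sublocale graded_module "(*)" "\<lambda>t. J \<inter> hom_comp t"
  by (rule graded_module_ideal[OF subspace_J])

lemma zcoeff_var_prod_power_mult:
  "zcoeff (var_prod F ^ k * m) \<beta> = zcoeff m (shift (- int k) F \<beta>)"
proof -
  have "(\<lambda>i. \<beta> i - int (\<Sum>i'<k. \<Sum>j\<in>F. Poly_Mapping.lookup (Poly_Mapping.single j 1) i)) =
      shift (- int k) F \<beta>"
    by (auto simp: shift_def lookup_single when_def)
  then show ?thesis
    by (simp add: var_prod_def Var_def single_prod single_power zcoeff_single_mult
        lookup_sum del: sum_constant of_nat_sum)
qed

text \<open>
  The coefficient of \<open>x\<^sup>\<alpha>\<close> in the component at \<open>F\<close> of the cochain represented by the pair \<open>c\<close>.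
\<close>

definition cochain_coeff :: "('n set \<Rightarrow> ('n, 'k) mpoly) \<times> nat \<Rightarrow> ('n \<Rightarrow> int) \<Rightarrow> 'n set \<Rightarrow> 'k" where
  "cochain_coeff c \<alpha> F = zcoeff (fst c F) (shift (int (snd c)) F \<alpha>)"

text \<open>
  The monomial \<open>x\<^sup>\<alpha>\<close> is a fraction with numerator in \<open>J\<close> and denominator \<open>x\<^sub>F ^ k\<close>.
\<close>

definition in_fraction :: "nat \<Rightarrow> ('n \<Rightarrow> int) \<Rightarrow> 'n set \<Rightarrow> bool" where
  "in_fraction k \<alpha> F \<longleftrightarrow> (\<forall>j. 0 \<le> shift (int k) F \<alpha> j) \<and> expo (shift (int k) F \<alpha>) \<in> E"

definition degree_sets :: "('n \<Rightarrow> int) \<Rightarrow> 'n set set" where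
  "degree_sets \<alpha> = {F. \<exists>k. in_fraction k \<alpha> F}"

lemma in_fraction_mono:
  assumes "in_fraction k \<alpha> F" "k \<le> l" "F \<subseteq> F'"
  shows "in_fraction l \<alpha> F'"
proof -
  have le: "shift (int k) F \<alpha> j \<le> shift (int l) F' \<alpha> j" for j
    using assms(2,3) by (auto simp: shift_def)
  have "expo (shift (int l) F' \<alpha>) \<in> E"
    by (rule E_up[of "expo (shift (int k) F \<alpha>)"]) (use assms(1) le in \<open>auto simp: in_fraction_def nat_mono\<close>)
  moreover have "0 \<le> shift (int l) F' \<alpha> j" for j
    using assms(1) le[of j] unfolding in_fraction_def by (meson order_trans)
  ultimately show ?thesis by (simp add: in_fraction_def)
qed

lemma cochain_coeff_zero [simp]: "cochain_coeff (\<lambda>_. 0, k) \<alpha> F = 0"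
  by (simp add: cochain_coeff_def)

text \<open>
  The Cech differential respects multidegrees: in multidegree \<open>\<alpha>\<close> it is the simplicial
  coboundary, because \<open>Var j ^ k\<close> translates exponents over \<open>F - {j}\<close> to those over \<open>F\<close>.
\<close>

lemma cochain_coeff_cech_d: "cochain_coeff (cech_d c) \<alpha> F = cobd (cochain_coeff c \<alpha>) F"
proof -
  obtain m k where c: "c = (m, k)" by (cases c)
  show ?thesis
    unfolding c cech_d.simps cochain_coeff_def cobd_def fst_conv snd_conv zcoeff_sum cech_sign_def
  proof (rule sum.cong[OF refl])
    fix j assume j: "j \<in> F"
    show "zcoeff ((- 1) ^ card {i \<in> F. i < j} * Var j ^ k * m (F - {j})) (shift (int k) F \<alpha>) =
        (- 1) ^ card {i \<in> F. i < j} * zcoeff (m (F - {j})) (shift (int k) (F - {j}) \<alpha>)"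
      unfolding mult.assoc zcoeff_sign zcoeff_Var_power_mult[OF j] ..
  qed
qed

lemma cochain_coeff_cech_diff: "cochain_coeff (cech_diff c c') \<alpha> F = cochain_coeff c \<alpha> F - cochain_coeff c' \<alpha> F"
  by (cases c; cases c') (simp add: cochain_coeff_def zcoeff_var_prod_power_mult)

text \<open>
  Monomials are not zero divisors, so fractions are equal iff they have the same Laurent
  expansion.
\<close>

lemma frac_eq_iff:
  "frac_eq F (a, k) (b, l) \<longleftrightarrow>
    (\<forall>\<alpha>. zcoeff a (shift (int k) F \<alpha>) = zcoeff b (shift (int l) F \<alpha>))" (is "?L \<longleftrightarrow> ?R")
proof
  assume ?L
  then obtain r where r: "var_prod F ^ r * (var_prod F ^ l * a - var_prod F ^ k * b) = 0" by auto
  show ?R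
  proof
    fix \<alpha>
    have "zcoeff (var_prod F ^ r * (var_prod F ^ l * a - var_prod F ^ k * b))
        (shift (int r + int k + int l) F \<alpha>) = 0"
      unfolding r by simp
    then show "zcoeff a (shift (int k) F \<alpha>) = zcoeff b (shift (int l) F \<alpha>)"
      by (simp add: zcoeff_var_prod_power_mult)
  qed
next
  assume R: ?R
  have "var_prod F ^ l * a = var_prod F ^ k * b"
  proof (rule zcoeff_ext)
    fix \<beta>
    show "zcoeff (var_prod F ^ l * a) \<beta> = zcoeff (var_prod F ^ k * b) \<beta>"
      using R[rule_format, of "shift (- int k - int l) F \<beta>"] by (simp add: zcoeff_var_prod_power_mult)
  qed
  then show ?L by simp
qed

lemma cech_eq_iff: "cech_eq p c c' \<longleftrightarrow> (\<forall>F. card F = p \<longrightarrow> (\<forall>\<alpha>. cochain_coeff c \<alpha> F = cochain_coeff c' \<alpha> F))"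
  by (cases c; cases c') (simp add: frac_eq_iff cochain_coeff_def del: frac_eq.simps)

lemma mem_graded_iff:
  "f \<in> J \<inter> hom_comp d \<longleftrightarrow>
    (\<forall>\<beta>. zcoeff f \<beta> \<noteq> 0 \<longrightarrow> (\<forall>j. 0 \<le> \<beta> j) \<and> expo \<beta> \<in> E \<and> (\<Sum>j\<in>UNIV. \<beta> j) = d)" (is "?L \<longleftrightarrow> ?R")
proof
  assume L: ?L
  show ?R
  proof (intro allI impI)
    fix \<beta> assume "zcoeff f \<beta> \<noteq> 0"
    then have "\<forall>j. 0 \<le> \<beta> j" "expo \<beta> \<in> Poly_Mapping.keys f"
      by (auto simp: zcoeff_def in_keys_iff split: if_splits)
    then show "(\<forall>j. 0 \<le> \<beta> j) \<and> expo \<beta> \<in> E \<and> (\<Sum>j\<in>UNIV. \<beta> j) = d"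
      using L mono_deg_expo[of \<beta>] by (auto simp: J_eq hom_comp_def)
  qed
next
  assume R: ?R
  have "e \<in> E \<and> int (mono_deg e) = d" if "e \<in> Poly_Mapping.keys f" for e
    using R[rule_format, of "\<lambda>j. int (Poly_Mapping.lookup e j)"] that
    by (simp add: zcoeff_def in_keys_iff mono_deg_def)
  then show ?L by (auto simp: J_eq hom_comp_def)
qed

lemma cochains_iff:
  "c \<in> cech_cochains p t \<longleftrightarrow>
    (\<forall>F. card F = p \<longrightarrow> (\<forall>\<alpha>. cochain_coeff c \<alpha> F \<noteq> 0 \<longrightarrow> in_fraction (snd c) \<alpha> F \<and> (\<Sum>j\<in>UNIV. \<alpha> j) = t))"
proof -
  obtain m k where c: "c = (m, k)" by (cases c)
  have "m F \<in> J \<inter> hom_comp (t + int (k * p)) \<longleftrightarrow>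
      (\<forall>\<alpha>. cochain_coeff c \<alpha> F \<noteq> 0 \<longrightarrow> in_fraction k \<alpha> F \<and> (\<Sum>j\<in>UNIV. \<alpha> j) = t)" if "card F = p" for F
  proof -
    have re: "(\<forall>\<beta>. P \<beta>) \<longleftrightarrow> (\<forall>\<alpha>. P (shift (int k) F \<alpha>))" for P
    proof
      assume a: "\<forall>\<alpha>. P (shift (int k) F \<alpha>)"
      have "P (shift (int k) F (shift (- int k) F \<beta>))" for \<beta> using a by blast
      then show "\<forall>\<beta>. P \<beta>" by simp
    qed simp
    then show ?thesis
      unfolding mem_graded_iff
        re[of "\<lambda>\<beta>. zcoeff (m F) \<beta> \<noteq> 0 \<longrightarrow> (\<forall>j. 0 \<le> \<beta> j) \<and> expo \<beta> \<in> E \<and> sum \<beta> UNIV = t + int (k * p)"]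
      using that by (simp add: in_fraction_def cochain_coeff_def c sum_shift conj_assoc)
  qed
  then show ?thesis by (auto simp: cech_cochains_def c)
qed

lemma zero_cochain: "(\<lambda>_. 0, 0) \<in> cech_cochains p t"
  by (simp add: cochains_iff)

lemma cocycles_iff:
  "c \<in> cech_cocycles p t \<longleftrightarrow>
    c \<in> cech_cochains p t \<and> (\<forall>F. card F = Suc p \<longrightarrow> (\<forall>\<alpha>. cobd (cochain_coeff c \<alpha>) F = 0))"
  by (simp add: cech_cocycles_def cech_eq_iff cochain_coeff_cech_d)

lemma cech_diff_cochains:
  assumes "c \<in> cech_cochains p t" "c' \<in> cech_cochains p t"
  shows "cech_diff c c' \<in> cech_cochains p t"
  unfolding cochains_iff
proof (intro allI impI)
  fix F :: "'n set" and \<alpha>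
  assume F: "card F = p" and "cochain_coeff (cech_diff c c') \<alpha> F \<noteq> 0"
  then have "cochain_coeff c \<alpha> F \<noteq> 0 \<or> cochain_coeff c' \<alpha> F \<noteq> 0" by (auto simp: cochain_coeff_cech_diff)
  then have "(in_fraction (snd c) \<alpha> F \<or> in_fraction (snd c') \<alpha> F) \<and> (\<Sum>j\<in>UNIV. \<alpha> j) = t"
    using assms F unfolding cochains_iff by blast
  moreover have "snd (cech_diff c c') = snd c + snd c'" by (cases c; cases c') simp
  ultimately show "in_fraction (snd (cech_diff c c')) \<alpha> F \<and> (\<Sum>j\<in>UNIV. \<alpha> j) = t"
    using in_fraction_mono[of _ \<alpha> F _ F] by auto
qed

lemma cobd_cong_card:
  assumes "card F = Suc q" "\<And>F'. card F' = q \<Longrightarrow> f F' = g F'"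
  shows "cobd f F = cobd g (F :: 'n set)"
proof -
  have "card (F - {j}) = q" if "j \<in> F" for j using assms(1) that by simp
  then show ?thesis unfolding cobd_def using assms(2) by (auto intro: sum.cong)
qed

lemma coboundaries_subset: "cech_coboundaries p t \<subseteq> cech_cocycles p t"
proof
  fix c assume c: "c \<in> cech_coboundaries p t"
  have "cobd (cochain_coeff c \<alpha>) F = 0" if F: "card F = Suc p" for F \<alpha>
  proof (cases p)
    case 0
    then have "cobd (cochain_coeff c \<alpha>) F = cobd (\<lambda>_. 0) F"
      using c by (intro cobd_cong_card[OF F]) (simp add: cech_coboundaries_def cech_eq_iff)
    then show ?thesis by (simp add: cobd_def)
  next
    case (Suc q)
    then obtain b where "cech_eq p c (cech_d b)" using c by (auto simp: cech_coboundaries_def)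
    then have "cobd (cochain_coeff c \<alpha>) F = cobd (cobd (cochain_coeff b \<alpha>)) F"
      by (intro cobd_cong_card[OF F]) (simp add: cech_eq_iff cochain_coeff_cech_d)
    then show ?thesis by (simp add: cobd_cobd)
  qed
  then show "c \<in> cech_cocycles p t" using c by (simp add: cocycles_iff cech_coboundaries_def)
qed

text \<open>
  Finitely many multidegrees can be prescribed independently: a common exponent \<open>k\<close> of the
  denominators exists since \<open>in_fraction\<close> is monotone in \<open>k\<close>.
\<close>

lemma exists_cochain:
  assumes A: "finite A" "\<And>\<alpha>. \<alpha> \<in> A \<Longrightarrow> (\<Sum>j\<in>UNIV. \<alpha> j) = t"
    and g: "\<And>\<alpha> F. \<alpha> \<in> A \<Longrightarrow> g \<alpha> F \<noteq> 0 \<Longrightarrow> F \<in> degree_sets \<alpha>"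
  shows "\<exists>b\<in>cech_cochains p t. \<forall>\<alpha> F. cochain_coeff b \<alpha> F = (if \<alpha> \<in> A then g \<alpha> F else 0)"
proof -
  define r where "r = (\<lambda>\<alpha> F. SOME k. in_fraction k \<alpha> F)"
  have r: "in_fraction (r \<alpha> F) \<alpha> F" if "F \<in> degree_sets \<alpha>" for \<alpha> F
    using that unfolding degree_sets_def r_def by (auto intro: someI)
  define k where "k = (\<Sum>\<alpha>\<in>A. \<Sum>F\<in>UNIV. r \<alpha> F)"
  have k: "in_fraction k \<alpha> F" if "\<alpha> \<in> A" "g \<alpha> F \<noteq> 0" for \<alpha> F
  proof -
    have "r \<alpha> F \<le> (\<Sum>F\<in>UNIV. r \<alpha> F)" by (rule member_le_sum) auto
    also have "\<dots> \<le> k" unfolding k_def using that A(1) by (intro member_le_sum) auto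
    finally show ?thesis using in_fraction_mono[OF r[OF g[OF that]]] by blast
  qed
  define m where "m = (\<lambda>F. \<Sum>\<alpha>\<in>A. Poly_Mapping.single (expo (shift (int k) F \<alpha>)) (g \<alpha> F))"
  have cochain_coeff: "cochain_coeff (m, k) \<alpha> F = (if \<alpha> \<in> A then g \<alpha> F else 0)" for \<alpha> F
  proof -
    have inj: "shift (int k) F \<alpha> = shift (int k) F \<alpha>' \<longleftrightarrow> \<alpha> = \<alpha>'" for \<alpha>'
      by (metis shift_shift shift_0 ab_left_minus)
    have "zcoeff (Poly_Mapping.single (expo (shift (int k) F \<alpha>')) (g \<alpha>' F)) (shift (int k) F \<alpha>) =
        (if \<alpha>' = \<alpha> then g \<alpha> F else 0)" if "\<alpha>' \<in> A" for \<alpha>'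
    proof (cases "g \<alpha>' F = 0")
      case False
      then show ?thesis using k[OF that False] inj[of \<alpha>'] by (auto simp: in_fraction_def zcoeff_single)
    qed auto
    then have "cochain_coeff (m, k) \<alpha> F = (\<Sum>\<alpha>'\<in>A. if \<alpha>' = \<alpha> then g \<alpha> F else 0)"
      by (simp add: cochain_coeff_def m_def)
    then show ?thesis using A(1) by simp
  qed
  have "(m, k) \<in> cech_cochains p t"
    unfolding cochains_iff using k A(2) by (auto simp: cochain_coeff split: if_splits)
  then show ?thesis using cochain_coeff by blast
qed

lemma finite_cochain_support: "finite {\<alpha>. \<exists>F. cochain_coeff c \<alpha> F \<noteq> 0}"
proof -
  obtain m k where c: "c = (m, k)" by (cases c)
  have "{\<alpha>. \<exists>F. cochain_coeff c \<alpha> F \<noteq> 0} \<subseteq>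
    (\<Union>F. (\<lambda>e. shift (- int k) F (\<lambda>j. int (Poly_Mapping.lookup e j))) ` Poly_Mapping.keys (m F))"
  proof
    fix \<alpha> assume "\<alpha> \<in> {\<alpha>. \<exists>F. cochain_coeff c \<alpha> F \<noteq> 0}"
    then obtain F where F: "\<forall>j. 0 \<le> shift (int k) F \<alpha> j" "expo (shift (int k) F \<alpha>) \<in> Poly_Mapping.keys (m F)"
      by (auto simp: c cochain_coeff_def zcoeff_def in_keys_iff split: if_splits)
    have "shift (- int k) F (\<lambda>j. int (Poly_Mapping.lookup (expo (shift (int k) F \<alpha>)) j)) =
        shift (- int k) F (shift (int k) F \<alpha>)" using F(1) by (simp add: nat_0_le)
    then have "\<alpha> = shift (- int k) F (\<lambda>j. int (Poly_Mapping.lookup (expo (shift (int k) F \<alpha>)) j))" by simp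
    then show "\<alpha> \<in> (\<Union>F. (\<lambda>e. shift (- int k) F (\<lambda>j. int (Poly_Mapping.lookup e j))) ` Poly_Mapping.keys (m F))"
      using F(2) by blast
  qed
  then show ?thesis by (rule finite_subset) simp
qed

text \<open>
  A cocycle has finitely many multidegrees, and it is a coboundary as soon as it is one in each
  of them.
\<close>

lemma local_cohomology_zero:
  assumes ex: "\<And>\<alpha>. (\<Sum>j\<in>UNIV. \<alpha> j) = t \<Longrightarrow> exact_at TYPE('k) (degree_sets \<alpha>) p"
  shows "local_cohomology p t = {cech_coboundaries p t}"
proof -
  have sub: "c \<in> cech_coboundaries p t" if "c \<in> cech_cocycles p t" for c
  proof -
    have coch: "c \<in> cech_cochains p t" and cyc: "\<And>F \<alpha>. card F = Suc p \<Longrightarrow> cobd (cochain_coeff c \<alpha>) F = 0"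
      using that by (auto simp: cocycles_iff)
    define A where "A = {\<alpha>. (\<exists>F. cochain_coeff c \<alpha> F \<noteq> 0) \<and> (\<Sum>j\<in>UNIV. \<alpha> j) = t}"
    have finA: "finite A" by (rule finite_subset[OF _ finite_cochain_support[of c]]) (auto simp: A_def)
    have "\<exists>g. (\<forall>F. g F \<noteq> 0 \<longrightarrow> F \<in> degree_sets \<alpha>) \<and> (\<forall>F. card F = p \<longrightarrow> cochain_coeff c \<alpha> F = cobd g F)"
      if "\<alpha> \<in> A" for \<alpha>
    proof -
      define f where "f = (\<lambda>F. if card F = p then cochain_coeff c \<alpha> F else 0)"
      have "F \<in> degree_sets \<alpha>" if "f F \<noteq> 0" for F
        using coch that unfolding cochains_iff f_def degree_sets_def by (auto split: if_splits)
      moreover have "cobd f F = 0" if "card F = Suc p" for F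
        using cobd_cong_card[OF that, of f "cochain_coeff c \<alpha>"] cyc[OF that] by (simp add: f_def)
      ultimately obtain g where "\<forall>F. g F \<noteq> 0 \<longrightarrow> F \<in> degree_sets \<alpha>" "\<forall>F. card F = p \<longrightarrow> f F = cobd g F"
        using ex[of \<alpha>] \<open>\<alpha> \<in> A\<close> unfolding exact_at_def A_def by blast
      then show ?thesis by (auto simp: f_def)
    qed
    then obtain g where g: "\<And>\<alpha> F. \<alpha> \<in> A \<Longrightarrow> g \<alpha> F \<noteq> 0 \<Longrightarrow> F \<in> degree_sets \<alpha>"
      "\<And>\<alpha> F. \<alpha> \<in> A \<Longrightarrow> card F = p \<Longrightarrow> cochain_coeff c \<alpha> F = cobd (g \<alpha>) F" by metis
    have off: "cochain_coeff c \<alpha> F = 0" if "\<alpha> \<notin> A" "card F = p" for \<alpha> F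
      using that coch unfolding cochains_iff A_def by blast
    show ?thesis
    proof (cases p)
      case 0
      then have "cochain_coeff c \<alpha> F = 0" if "card F = 0" for \<alpha> F
        using g(2)[of \<alpha> F] off[of \<alpha> F] that by (cases "\<alpha> \<in> A") (auto simp: cobd_def)
      then show ?thesis using coch 0 by (simp add: cech_coboundaries_def cech_eq_iff)
    next
      case (Suc q)
      obtain b where b: "b \<in> cech_cochains q t" "\<And>\<alpha> F. cochain_coeff b \<alpha> F = (if \<alpha> \<in> A then g \<alpha> F else 0)"
        using exists_cochain[of A t g q] finA g(1) A_def by blast
      have "cochain_coeff c \<alpha> F = cobd (cochain_coeff b \<alpha>) F" if "card F = p" for F \<alpha>
      proof (cases "\<alpha> \<in> A")
        case True
        then have "cochain_coeff b \<alpha> = g \<alpha>" using b(2) by auto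
        then show ?thesis using g(2) True that by simp
      next
        case False
        then show ?thesis using off[OF False that] b(2) by (simp add: cobd_def)
      qed
      then have "cech_eq p c (cech_d b)" by (simp add: cech_eq_iff cochain_coeff_cech_d)
      then show ?thesis using b(1) coch Suc by (auto simp: cech_coboundaries_def)
    qed
  qed
  have diff: "cech_diff c c' \<in> cech_coboundaries p t"
    if "c \<in> cech_cocycles p t" "c' \<in> cech_cocycles p t" for c c'
  proof (rule sub)
    have "cochain_coeff (cech_diff c c') \<alpha> = (\<lambda>F. cochain_coeff c \<alpha> F - cochain_coeff c' \<alpha> F)" for \<alpha> by (rule ext) (rule cochain_coeff_cech_diff)
    then show "cech_diff c c' \<in> cech_cocycles p t"
      using that by (simp add: cocycles_iff cech_diff_cochains cobd_diff)
  qed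
  have eq: "cech_cocycles p t = cech_coboundaries p t" using sub coboundaries_subset by blast
  have "{(c, c'). c \<in> cech_cocycles p t \<and> c' \<in> cech_cocycles p t \<and>
      cech_diff c c' \<in> cech_coboundaries p t} = cech_cocycles p t \<times> cech_cocycles p t"
    using diff by (auto simp del: cech_diff.simps)
  moreover have "(Z \<times> Z) `` {z} = Z" if "z \<in> Z" for z and Z :: "(('n set \<Rightarrow> ('n, 'k) mpoly) \<times> nat) set"
    using that by auto
  moreover have "(\<lambda>_. 0, 0) \<in> cech_cocycles p t" by (simp add: cocycles_iff zero_cochain cobd_def)
  ultimately show ?thesis
    unfolding local_cohomology_def quotient_def eq by auto
qed

text \<open>
  Conversely, a cocycle of a single multidegree that is no coboundary there, taken as a Cech
  cochain, is no Cech coboundary either.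
\<close>

lemma local_cohomology_nonzero:
  assumes \<alpha>: "(\<Sum>j\<in>UNIV. \<alpha> j) = t" and ex: "\<not> exact_at TYPE('k) (degree_sets \<alpha>) p"
  shows "local_cohomology p t \<noteq> {cech_coboundaries p t}"
proof
  assume eq: "local_cohomology p t = {cech_coboundaries p t}"
  have "\<exists>f :: 'n set \<Rightarrow> 'k. (\<forall>F. f F \<noteq> 0 \<longrightarrow> F \<in> degree_sets \<alpha>) \<and> (\<forall>F. card F = Suc p \<longrightarrow> cobd f F = 0) \<and>
      \<not> (\<exists>g. (\<forall>F. g F \<noteq> 0 \<longrightarrow> F \<in> degree_sets \<alpha>) \<and> (\<forall>F. card F = p \<longrightarrow> f F = cobd g F))"
    using ex unfolding exact_at_def not_all not_imp .
  then obtain f :: "'n set \<Rightarrow> 'k" where f: "\<And>F. f F \<noteq> 0 \<Longrightarrow> F \<in> degree_sets \<alpha>"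
    "\<And>F. card F = Suc p \<Longrightarrow> cobd f F = 0"
    and no: "\<not> (\<exists>g. (\<forall>F. g F \<noteq> 0 \<longrightarrow> F \<in> degree_sets \<alpha>) \<and> (\<forall>F. card F = p \<longrightarrow> f F = cobd g F))"
    by (elim exE conjE) (rule that; simp)
  have not_cobd: "\<exists>F. card F = p \<and> f F \<noteq> cobd g F" if "\<And>F. g F \<noteq> 0 \<Longrightarrow> F \<in> degree_sets \<alpha>" for g
  proof (rule ccontr)
    assume "\<not> (\<exists>F. card F = p \<and> f F \<noteq> cobd g F)"
    then have "(\<forall>F. g F \<noteq> 0 \<longrightarrow> F \<in> degree_sets \<alpha>) \<and> (\<forall>F. card F = p \<longrightarrow> f F = cobd g F)"
      using that by simp
    with no show False by (elim notE) (rule exI)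
  qed
  obtain c where c: "c \<in> cech_cochains p t" "\<And>\<alpha>' F. cochain_coeff c \<alpha>' F = (if \<alpha>' \<in> {\<alpha>} then f F else 0)"
    using exists_cochain[of "{\<alpha>}" t "\<lambda>_. f" p] \<alpha> f(1) by auto
  have cochain_coeff: "cochain_coeff c \<alpha>' = (if \<alpha>' = \<alpha> then f else (\<lambda>_. 0))" for \<alpha>' using c(2) by auto
  have cyc: "c \<in> cech_cocycles p t"
    using c(1) f(2) by (simp add: cocycles_iff cochain_coeff) (simp add: cobd_def)
  have "cech_diff c c \<in> cech_coboundaries p t"
  proof (cases p)
    case (Suc q)
    have "cech_eq p (cech_diff c c) (cech_d (\<lambda>_. 0, 0))"
      unfolding cech_eq_iff cochain_coeff_cech_d by (simp add: cochain_coeff_cech_diff cobd_def)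
    then have "\<exists>b\<in>cech_cochains q t. cech_eq p (cech_diff c c) (cech_d b)"
      using zero_cochain by (rule bexI)
    then show ?thesis
      using Suc c(1) by (simp add: cech_coboundaries_def cech_diff_cochains)
  qed (use c(1) in \<open>simp add: cech_coboundaries_def cech_diff_cochains cech_eq_iff cochain_coeff_cech_diff\<close>)
  moreover have "{c'. c' \<in> cech_cocycles p t \<and> cech_diff c c' \<in> cech_coboundaries p t} \<in> local_cohomology p t"
    unfolding local_cohomology_def quotient_def using cyc by auto
  ultimately have cob: "c \<in> cech_coboundaries p t" using eq cyc by blast
  show False
  proof (cases p)
    case 0
    then have "f F = 0" if "card F = 0" for F
      using cob that cochain_coeff[of \<alpha>] by (auto simp: cech_coboundaries_def cech_eq_iff)
    then show False using not_cobd[of "\<lambda>_. 0"] 0 by (auto simp: cobd_def)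
  next
    case (Suc q)
    then obtain b where b: "b \<in> cech_cochains q t" "cech_eq p c (cech_d b)"
      using cob by (auto simp: cech_coboundaries_def)
    define g where "g = (\<lambda>F. if card F = q then cochain_coeff b \<alpha> F else 0)"
    have "F \<in> degree_sets \<alpha>" if "g F \<noteq> 0" for F
      using b(1) that unfolding cochains_iff g_def degree_sets_def by (auto split: if_splits)
    moreover have "f F = cobd g F" if F: "card F = p" for F
    proof -
      have "f F = cobd (cochain_coeff b \<alpha>) F"
        using b(2) F cochain_coeff[of \<alpha>] by (auto simp: cech_eq_iff cochain_coeff_cech_d)
      also have "\<dots> = cobd g F"
        by (rule cobd_cong_card[OF F[unfolded Suc]]) (simp add: g_def)
      finally show ?thesis .
    qed
    ultimately show False using not_cobd[of g] by blast
  qed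
qed

lemma regularity_eqI:
  fixes R :: int
  assumes upper: "\<And>\<alpha> p. (\<Sum>j\<in>UNIV. \<alpha> j) + int p > R \<Longrightarrow> exact_at TYPE('k) (degree_sets \<alpha>) p"
    and lower: "(\<Sum>j\<in>UNIV. \<alpha>0 j) + int p0 = R" "\<not> exact_at TYPE('k) (degree_sets \<alpha>0) p0"
  shows "ideal_reg J = ereal (of_int R)"
proof -
  have "regularity = ereal (of_int R)"
    unfolding regularity_def
  proof (rule antisym)
    show "(SUP p. a_invariant p + ereal (of_nat p)) \<le> ereal (of_int R)"
    proof (rule SUP_least)
      fix p
      have "a_invariant p \<le> ereal (of_int (R - int p))"
        unfolding a_invariant_def
      proof (rule SUP_least)
        fix t assume t: "t \<in> {t. local_cohomology p t \<noteq> {cech_coboundaries p t}}"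
        have "\<not> t + int p > R"
        proof
          assume "t + int p > R"
          then have "local_cohomology p t = {cech_coboundaries p t}"
            by (intro local_cohomology_zero upper) simp
          then show False using t by simp
        qed
        then show "ereal (of_int t) \<le> ereal (of_int (R - int p))" by simp
      qed
      then have "a_invariant p + ereal (of_nat p) \<le> ereal (of_int (R - int p)) + ereal (of_nat p)"
        by (rule add_right_mono)
      then show "a_invariant p + ereal (of_nat p) \<le> ereal (of_int R)" by simp
    qed
    let ?t = "\<Sum>j\<in>UNIV. \<alpha>0 j"
    have "ereal (of_int ?t) \<le> a_invariant p0"
      unfolding a_invariant_def
      by (rule SUP_upper) (use local_cohomology_nonzero[OF refl lower(2)] in simp)
    then have "ereal (of_int ?t) + ereal (of_nat p0) \<le> a_invariant p0 + ereal (of_nat p0)"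
      by (rule add_right_mono)
    also have "\<dots> \<le> (SUP p. a_invariant p + ereal (of_nat p))" by (rule SUP_upper) simp
    also have "ereal (of_int ?t) + ereal (of_nat p0) = ereal (of_int R)"
      using lower(1) by (metis of_int_add of_int_of_nat_eq plus_ereal.simps(1))
    finally show "ereal (of_int R) \<le> (SUP p. a_invariant p + ereal (of_nat p))" .
  qed
  then show ?thesis by (simp add: ideal_reg_def)
qed

end

section \<open>Powers of an ideal of coprime monomials\<close>

text \<open>
  Pairwise coprime monomials \<open>u\<^sub>1, \<dots>, u\<^sub>s\<close> are encoded by the map \<open>gr\<close> that sends a variable to the
  index of the only \<open>u\<^sub>i\<close> that it divides, or to \<open>0\<close>, and by its exponent \<open>w\<close> in this \<open>u\<^sub>i\<close>.
\<close>

locale coprime_powers =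
  fixes gr :: "'n::{finite,linorder} \<Rightarrow> nat" and w :: "'n \<Rightarrow> nat" and s n :: nat
  assumes s: "s \<ge> 1" and n: "n \<ge> 1" and gr_le: "\<And>v. gr v \<le> s"
    and gr_onto: "\<And>i. i \<in> {1..s} \<Longrightarrow> \<exists>v. gr v = i"
    and w_pos: "\<And>v. gr v \<noteq> 0 \<Longrightarrow> w v > 0"
    and deg_le: "\<And>i. i \<in> {1..s} \<Longrightarrow> (\<Sum>v | gr v = i. w v) \<le> (\<Sum>v | gr v = 1. w v)"
begin

definition group_deg :: "nat \<Rightarrow> nat" where
  "group_deg i = (\<Sum>v | gr v = i. w v)"

text \<open>
  The exponents of the monomials in \<open>(u\<^sub>1, \<dots>, u\<^sub>s)\<^sup>n\<close>: those divisible by some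
  \<open>u\<^sub>1 ^ c 1 * \<dots> * u\<^sub>s ^ c s\<close> of order at least \<open>n\<close>.
\<close>

definition power_exps :: "('n \<Rightarrow>\<^sub>0 nat) set" where
  "power_exps = {e. \<exists>c. n \<le> (\<Sum>i = 1..s. c i) \<and> (\<forall>v. gr v \<noteq> 0 \<longrightarrow> c (gr v) * w v \<le> Poly_Mapping.lookup e v)}"

text \<open>
  The sets \<open>F\<close> such that \<open>x\<^sup>\<alpha>\<close> lies in the localization of the power at the variables in \<open>F\<close>:
  after inverting them, they impose no condition on \<open>\<alpha>\<close>. See \<open>degree_sets_powers\<close> below.
\<close>

definition power_sets :: "('n \<Rightarrow> int) \<Rightarrow> 'n set set" where
  "power_sets \<alpha> = {F. {v. \<alpha> v < 0} \<subseteq> F \<and>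
     (\<exists>c. n \<le> (\<Sum>i = 1..s. c i) \<and> (\<forall>v. v \<notin> F \<longrightarrow> gr v \<noteq> 0 \<longrightarrow> int (c (gr v) * w v) \<le> \<alpha> v))}"

definition reg :: int where
  "reg = int (n * group_deg 1) + (\<Sum>i = 2..s. int (group_deg i)) - (int s - 1)"

lemma gr_range: "gr v \<noteq> 0 \<Longrightarrow> gr v \<in> {1..s}"
  using gr_le[of v] by simp

lemma group_deg_pos: "i \<in> {1..s} \<Longrightarrow> group_deg i \<ge> 1"
proof -
  assume i: "i \<in> {1..s}"
  then obtain v where v: "gr v = i" using gr_onto by blast
  then have "w v \<le> group_deg i" unfolding group_deg_def by (intro member_le_sum) auto
  then show ?thesis using w_pos[of v] v i by simp
qed

lemma up_closed_power_sets: "up_closed (power_sets \<alpha>)"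
  unfolding up_closed_def power_sets_def by blast

lemma sum_groups: "(\<Sum>v | gr v \<noteq> 0. h v) = (\<Sum>i = 1..s. \<Sum>v | gr v = i. (h v :: int))"
proof -
  have "(\<Sum>i = 1..s. \<Sum>v | gr v = i. h v) = (\<Sum>i\<in>{1..s}. \<Sum>v\<in>{v \<in> {v. gr v \<noteq> 0}. gr v = i}. h v)"
    by (intro sum.cong refl) auto
  also have "\<dots> = (\<Sum>v | gr v \<noteq> 0. h v)"
    by (rule sum.group) (use gr_range in auto)
  finally show ?thesis by simp
qed

lemma sum_split_first: "(\<Sum>i = 1..s. h i) = (h 1 :: int) + (\<Sum>i = 2..s. h i)"
  using s by (simp add: sum.atLeast_Suc_atMost numeral_2_eq_2)

lemma reg_eq: "reg + int s - 1 = (int n - 1) * int (group_deg 1) + (\<Sum>i = 1..s. int (group_deg i))"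
  unfolding reg_def sum_split_first by (simp add: algebra_simps)

lemma reg_nonneg: "reg \<ge> 0"
proof -
  have "(\<Sum>i = 2..s. 1) \<le> (\<Sum>i = 2..s. int (group_deg i))"
    using group_deg_pos by (intro sum_mono) force
  moreover have "(\<Sum>i = 2..s. 1 :: int) = int s - 1" using s by simp
  moreover have "0 \<le> int (n * group_deg 1)" by (rule of_nat_0_le_iff)
  ultimately show ?thesis unfolding reg_def by linarith
qed

lemma mem_power_sets_if_group_subset:
  fixes \<alpha> :: "'n \<Rightarrow> int"
  assumes "{v. \<alpha> v < 0} \<subseteq> F" "i \<in> {1..s}" "{v. gr v = i} \<subseteq> F"
  shows "F \<in> power_sets \<alpha>"
proof -
  have "(\<Sum>i' = 1..s. if i' = i then n else 0) = n" using assms(2) by simp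
  moreover have "int ((if gr v = i then n else 0) * w v) \<le> \<alpha> v" if "v \<notin> F" for v
    using assms(1,3) that by force
  ultimately show ?thesis using assms(1) unfolding power_sets_def
    by (intro CollectI conjI exI[of _ "\<lambda>i'. if i' = i then n else 0"]) auto
qed

lemma exact_at_negative_cone:
  fixes \<alpha> :: "'n \<Rightarrow> int"
  assumes "0 \<le> \<alpha> v" "\<And>F. {v. \<alpha> v < 0} \<subseteq> F \<Longrightarrow> F \<in> \<Delta>" "\<And>F. F \<in> \<Delta> \<Longrightarrow> {v. \<alpha> v < 0} \<subseteq> F"
  shows "exact_at (K :: 'k::field itself) (\<Delta> :: 'n set set) p"
proof (rule exact_at_cone)
  show "up_closed \<Delta>" unfolding up_closed_def using assms(2,3) by (meson order_trans)
  show "F - {v} \<in> \<Delta>" if "F \<in> \<Delta>" for F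
    using assms(3)[OF that] assms(1) by (intro assms(2)) auto
qed

text \<open>
  Let \<open>M i\<close> be the largest quotient \<open>\<alpha> v div w v\<close> in group \<open>i\<close>, attained at \<open>top_var i\<close>. Group \<open>i\<close> is
  bad for \<open>F\<close> if some \<open>v\<close> outside \<open>F\<close> has a smaller quotient. Then \<open>top_var i\<close> may be added or
  removed freely, as it never is the variable that limits the power of \<open>u\<^sub>i\<close>. If no group is
  bad, then \<open>F\<close> is in the family with the exponents \<open>M\<close>, as these have sum at least \<open>n\<close>, and
  removing \<open>top_var 1\<close> does not change this. So the first bad group, or \<open>s + 1\<close> if there is none, is
  the rank of an acyclic matching.
\<close>

lemma exact_at_large_quotients:
  fixes \<alpha> :: "'n \<Rightarrow> int"
  assumes top_var: "\<And>i. i \<in> {1..s} \<Longrightarrow> gr (top_var i) = i \<and> int (M i * w (top_var i)) \<le> \<alpha> (top_var i)"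
    and M: "\<And>v. gr v \<noteq> 0 \<Longrightarrow> 0 \<le> \<alpha> v \<Longrightarrow> \<alpha> v < int ((M (gr v) + 1) * w v)"
    and le: "n \<le> (\<Sum>i = 1..s. M i)"
  shows "exact_at (K :: 'k::field itself) (power_sets \<alpha>) p"
proof -
  define bad where "bad = (\<lambda>F i. \<exists>v. i = gr v \<and> i \<noteq> 0 \<and> v \<notin> F \<and> 0 \<le> \<alpha> v \<and> \<alpha> v < int (M i * w v))"
  define rk where "rk = (\<lambda>F. LEAST i. bad F i \<or> i = Suc s)"
  \<comment> \<open>When no group is bad, any of the \<open>top_var i\<close> would do.\<close>
  define piv where "piv = (\<lambda>r. top_var (if r = Suc s then 1 else r))"
  have bad_range: "i \<in> {1..s}" if "bad F i" for F i
    using that gr_range unfolding bad_def by auto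
  have rk: "bad F (rk F) \<or> rk F = Suc s" for F
    unfolding rk_def by (rule LeastI[of _ "Suc s"]) simp
  have none: "\<not> bad F i" if "rk F = Suc s" for F i
  proof
    assume "bad F i"
    then have "rk F \<le> i" unfolding rk_def by (intro Least_le) simp
    then show False using bad_range[OF \<open>bad F i\<close>] that by simp
  qed
  have top_var_nonneg: "0 \<le> \<alpha> (top_var i)" if "i \<in> {1..s}" for i
    using top_var[OF that] by (meson of_nat_0_le_iff order_trans)
  have piv_top_var: "\<exists>i\<in>{1..s}. piv (rk F) = top_var i \<and> (bad F i \<or> rk F = Suc s)" for F
    using rk[of F] bad_range[of F "rk F"] s unfolding piv_def by auto
  have same: "bad F' i = bad F i" if "insert (piv (rk G)) F' = insert (piv (rk G)) F" for F F' G i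
  proof -
    obtain j where j: "j \<in> {1..s}" "piv (rk G) = top_var j" using piv_top_var by blast
    have "v \<noteq> top_var j" if "i = gr v" "\<alpha> v < int (M i * w v)" for v
      using top_var[OF j(1)] that by auto
    moreover have "v \<notin> F \<longleftrightarrow> v \<notin> F'" if "v \<noteq> top_var j" for v
      using that \<open>insert (piv (rk G)) F' = insert (piv (rk G)) F\<close> unfolding j(2) by blast
    ultimately show ?thesis unfolding bad_def by blast
  qed
  show ?thesis
  proof (rule exact_at_matching[where rk = rk and v = piv])
    show "up_closed (power_sets \<alpha>)" by (rule up_closed_power_sets)
    show "rk F \<le> rk F'" if "F \<subseteq> F'" for F F'
    proof -
      have "bad F (rk F') \<or> rk F' = Suc s" using rk[of F'] that unfolding bad_def by blast
      then have "(LEAST i. bad F i \<or> i = Suc s) \<le> rk F'" by (rule Least_le)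
      then show ?thesis by (simp add: rk_def)
    qed
    have "bad (insert (piv (rk F)) F) = bad F" for F by (rule ext, rule same[where G = F]) auto
    then show "rk (insert (piv (rk F)) F) = rk F" for F by (simp add: rk_def)
    have "bad (F - {piv (rk F)}) = bad F" for F by (rule ext, rule same[where G = F]) auto
    then show "rk (F - {piv (rk F)}) = rk F" for F by (simp add: rk_def)
    show "F - {piv (rk F)} \<in> power_sets \<alpha>" if F: "F \<in> power_sets \<alpha>" for F
    proof -
      obtain i where i: "i \<in> {1..s}" "piv (rk F) = top_var i" "bad F i \<or> rk F = Suc s"
        using piv_top_var by blast
      have gi: "gr (top_var i) = i" "i \<noteq> 0" "w (top_var i) > 0" using top_var i(1) w_pos[of "top_var i"] by auto
      have neg: "{v. \<alpha> v < 0} \<subseteq> F - {top_var i}" using F top_var_nonneg[OF i(1)] unfolding power_sets_def by auto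
      obtain c where c: "n \<le> (\<Sum>i = 1..s. c i)"
        "\<And>v. v \<notin> F \<Longrightarrow> gr v \<noteq> 0 \<Longrightarrow> int (c (gr v) * w v) \<le> \<alpha> v"
        using F unfolding power_sets_def by blast
      consider "bad F i" | "rk F = Suc s" using i(3) by blast
      then show ?thesis
      proof cases
        case 1
        then obtain v where v: "i = gr v" "v \<notin> F" "\<alpha> v < int (M i * w v)" unfolding bad_def by blast
        have "int (c i * w v) \<le> \<alpha> v" using c(2)[OF v(2)] v(1) gi by simp
        then have "int (c i * w v) < int (M i * w v)" using v(3) by linarith
        then have "c i * w v < M i * w v" by (simp only: of_nat_less_iff)
        then have "c i \<le> M i" by simp
        then have "c i * w (top_var i) \<le> M i * w (top_var i)" by simp
        then have "int (c i * w (top_var i)) \<le> \<alpha> (top_var i)" using top_var[OF i(1)] by linarith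
        then have "int (c (gr v) * w v) \<le> \<alpha> v" if "v \<notin> F - {top_var i}" "gr v \<noteq> 0" for v
          using c(2)[of v] that gi by auto
        then show ?thesis using neg c(1) unfolding power_sets_def i(2) by blast
      next
        case 2
        have "int (M (gr v) * w v) \<le> \<alpha> v" if v: "v \<notin> F - {top_var i}" "gr v \<noteq> 0" for v
        proof (cases "v = top_var i")
          case True
          then show ?thesis using top_var[OF i(1)] by simp
        next
          case False
          then have "v \<notin> F" "0 \<le> \<alpha> v" using v neg by (auto simp: subset_iff not_less[symmetric])
          then show ?thesis using none[OF 2, of "gr v"] v(2) unfolding bad_def by auto
        qed
        then show ?thesis using neg le unfolding power_sets_def i(2) by blast
      qed
    qed
  qed
qed

text \<open>
  If all exponents are negative, then \<open>p\<close> exceeds the number of variables. Otherwise, if a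
  variable of group \<open>0\<close> has a nonnegative exponent, or a group has only negative exponents, the
  family is a cone. If the largest quotients \<open>M i\<close> have sum at least \<open>n\<close>, the previous lemma
  applies. In the remaining case \<open>\<alpha> v < (M (gr v) + 1) * w v\<close> and \<open>\<Sum>M \<le> n - 1\<close>, so the degree is
  so small that \<open>p\<close> exceeds the number of variables minus \<open>s - 1\<close>. Sets of cardinality at least
  \<open>p - 1\<close> then omit fewer than \<open>s\<close> variables, hence contain a whole group, and the family looks
  like a full cone from position \<open>p - 1\<close> on.
\<close>

lemma exact_at_above_reg:
  fixes \<alpha> :: "'n \<Rightarrow> int"
  assumes big: "(\<Sum>v\<in>UNIV. \<alpha> v) + int p > reg"
  shows "exact_at (K :: 'k::field itself) (power_sets \<alpha>) p"
proof (cases "\<exists>v. 0 \<le> \<alpha> v")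
  case False
  then have "\<alpha> v \<le> - 1" for v by (metis not_le zle_diff1_eq diff_0)
  then have "(\<Sum>v\<in>UNIV. \<alpha> v) \<le> (\<Sum>v\<in>(UNIV :: 'n set). - 1)" by (intro sum_mono)
  then have p: "p > card (UNIV :: 'n set)" using big reg_nonneg by simp
  have "card F \<noteq> p" for F :: "'n set" using p card_mono[of UNIV F] by auto
  then show ?thesis unfolding exact_at_def by (intro allI impI exI[of _ "\<lambda>_. 0"]) auto
next
  case True
  then obtain v0 where v0: "0 \<le> \<alpha> v0" by blast
  show ?thesis
  proof (cases "(\<exists>i\<in>{1..s}. \<forall>v. gr v = i \<longrightarrow> \<alpha> v < 0) \<or> (\<exists>v. gr v = 0 \<and> 0 \<le> \<alpha> v)")
    case True
    then show ?thesis
    proof (elim disjE bexE exE conjE)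
      fix i assume i: "i \<in> {1..s}" "\<forall>v. gr v = i \<longrightarrow> \<alpha> v < 0"
      show ?thesis
      proof (rule exact_at_negative_cone[of \<alpha> v0, OF v0])
        fix F assume F: "{v. \<alpha> v < 0} \<subseteq> F"
        show "F \<in> power_sets \<alpha>" by (rule mem_power_sets_if_group_subset[OF F i(1)]) (use F i(2) in auto)
      qed (simp add: power_sets_def)
    next
      fix v assume v: "gr v = 0" "0 \<le> \<alpha> v"
      show ?thesis
      proof (rule exact_at_cone[OF up_closed_power_sets])
        fix F assume F: "F \<in> power_sets \<alpha>"
        then obtain c where "{v. \<alpha> v < 0} \<subseteq> F" "n \<le> (\<Sum>i = 1..s. c i)"
          "\<And>v. v \<notin> F \<Longrightarrow> gr v \<noteq> 0 \<Longrightarrow> int (c (gr v) * w v) \<le> \<alpha> v"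
          unfolding power_sets_def by blast
        then show "F - {v} \<in> power_sets \<alpha>" using v unfolding power_sets_def by force
      qed
    qed
  next
    case False
    have zero_neg: "\<alpha> v < 0" if "gr v = 0" for v
    proof (rule ccontr)
      assume "\<not> \<alpha> v < 0"
      then have "\<exists>v. gr v = 0 \<and> 0 \<le> \<alpha> v" using that by (intro exI[of _ v]) simp
      then show False using False by simp
    qed
    \<comment> \<open>The largest power of \<open>u\<^sub>i\<close> allowed by the variable \<open>v\<close>.\<close>
    define b where "b = (\<lambda>v. nat (\<alpha> v div int (w v)))"
    define M where "M = (\<lambda>i. Max (b ` {v. gr v = i \<and> 0 \<le> \<alpha> v}))"
    have ne: "{v. gr v = i \<and> 0 \<le> \<alpha> v} \<noteq> {}" if "i \<in> {1..s}" for i using False that by force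
    have b: "int (b v * w v) \<le> \<alpha> v \<and> \<alpha> v < int ((b v + 1) * w v)" if "gr v \<noteq> 0" "0 \<le> \<alpha> v" for v
    proof -
      define q r where "q = \<alpha> v div int (w v) * int (w v)" and "r = \<alpha> v mod int (w v)"
      have "int (b v) = \<alpha> v div int (w v)" using that by (simp add: b_def div_int_pos_iff)
      then have eqs: "int (b v * w v) = q" "int ((b v + 1) * w v) = q + int (w v)"
        by (simp_all add: q_def algebra_simps)
      have "\<alpha> v = q + r" by (simp add: q_def r_def)
      moreover have "0 \<le> r" "r < int (w v)" using w_pos[OF that(1)] by (auto simp: r_def)
      ultimately show ?thesis unfolding eqs by linarith
    qed
    have "\<exists>v. gr v = i \<and> 0 \<le> \<alpha> v \<and> b v = M i" if "i \<in> {1..s}" for i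
    proof -
      have "M i \<in> b ` {v. gr v = i \<and> 0 \<le> \<alpha> v}" unfolding M_def by (rule Max_in) (use ne[OF that] in auto)
      then show ?thesis by auto
    qed
    then obtain top_var where top_var: "\<And>i. i \<in> {1..s} \<Longrightarrow> gr (top_var i) = i \<and> 0 \<le> \<alpha> (top_var i) \<and> b (top_var i) = M i"
      by metis
    have M: "\<alpha> v < int ((M (gr v) + 1) * w v)" if v: "gr v \<noteq> 0" "0 \<le> \<alpha> v" for v
    proof -
      have "b v \<le> M (gr v)" unfolding M_def by (rule Max_ge) (use v in auto)
      then have "(b v + 1) * w v \<le> (M (gr v) + 1) * w v" by simp
      then have "int ((b v + 1) * w v) \<le> int ((M (gr v) + 1) * w v)" by (rule zle_int[THEN iffD2])
      then show ?thesis using b[OF v] by linarith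
    qed
    show ?thesis
    proof (cases "n \<le> (\<Sum>i = 1..s. M i)")
      case True
      show ?thesis
      proof (rule exact_at_large_quotients[OF _ M True])
        fix i assume i: "i \<in> {1..s}"
        then show "gr (top_var i) = i \<and> int (M i * w (top_var i)) \<le> \<alpha> (top_var i)"
          using top_var[OF i] b[of "top_var i"] by auto
      qed
    next
      case small: False
      have "(\<Sum>v\<in>UNIV. \<alpha> v) + int (card (UNIV :: 'n set)) = (\<Sum>v\<in>UNIV. \<alpha> v + 1)"
        by (simp add: sum.distrib)
      also have "\<dots> \<le> (\<Sum>v\<in>UNIV. if gr v \<noteq> 0 then int ((M (gr v) + 1) * w v) else 0)"
      proof (rule sum_mono)
        fix v
        show "\<alpha> v + 1 \<le> (if gr v \<noteq> 0 then int ((M (gr v) + 1) * w v) else 0)"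
        proof (cases "gr v \<noteq> 0 \<and> 0 \<le> \<alpha> v")
          case True
          then show ?thesis using M[of v] by auto
        next
          case neg: False
          then have "\<alpha> v < 0" using zero_neg[of v] by linarith
          then have "\<alpha> v + 1 \<le> 0" by simp
          also have "0 \<le> (if gr v \<noteq> 0 then int ((M (gr v) + 1) * w v) else 0)" by simp
          finally show ?thesis .
        qed
      qed
      also have "\<dots> = (\<Sum>v | gr v \<noteq> 0. int ((M (gr v) + 1) * w v))"
        by (simp add: sum.If_cases)
      also have "\<dots> = (\<Sum>i = 1..s. \<Sum>v | gr v = i. int ((M (gr v) + 1) * w v))"
        by (rule sum_groups)
      also have "\<dots> = (\<Sum>i = 1..s. int (M i + 1) * int (group_deg i))"
        by (intro sum.cong refl) (simp add: group_deg_def sum_distrib_left algebra_simps)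
      also have "\<dots> \<le> (\<Sum>i = 1..s. int (M i) * int (group_deg 1) + int (group_deg i))"
      proof (rule sum_mono)
        fix i assume "i \<in> {1..s}"
        then have "int (M i) * int (group_deg i) \<le> int (M i) * int (group_deg 1)"
          using deg_le by (intro mult_left_mono) (auto simp: group_deg_def simp flip: of_nat_sum)
        then show "int (M i + 1) * int (group_deg i) \<le> int (M i) * int (group_deg 1) + int (group_deg i)"
          by (simp add: algebra_simps)
      qed
      also have "\<dots> = int (\<Sum>i = 1..s. M i) * int (group_deg 1) + (\<Sum>i = 1..s. int (group_deg i))"
        by (simp add: sum.distrib sum_distrib_right)
      also have "\<dots> \<le> (int n - 1) * int (group_deg 1) + (\<Sum>i = 1..s. int (group_deg i))"
        using small by (intro add_right_mono mult_right_mono) (linarith, simp)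
      also have "\<dots> = reg + int s - 1" by (simp add: reg_eq)
      finally have p: "int p > int (card (UNIV :: 'n set)) - int s + 1" using big by simp
      have mem: "F \<in> power_sets \<alpha>" if F: "{v. \<alpha> v < 0} \<subseteq> F" "Suc (card F) = p" for F
      proof (rule ccontr)
        assume no: "F \<notin> power_sets \<alpha>"
        have "{1..s} \<subseteq> gr ` (- F)"
        proof
          fix i assume i: "i \<in> {1..s}"
          then have "\<not> {v. gr v = i} \<subseteq> F" using mem_power_sets_if_group_subset[OF F(1) i] no by blast
          then show "i \<in> gr ` (- F)" by blast
        qed
        then have "s \<le> card (gr ` (- F))" using card_mono[of "gr ` (- F)" "{1..s}"] by simp
        also have "\<dots> \<le> card (- F)" by (rule card_image_le) simp
        also have "\<dots> = card (UNIV :: 'n set) - card F"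
          by (simp add: Compl_eq_Diff_UNIV card_Diff_subset)
        finally show False using p F(2) s by linarith
      qed
      have "exact_at K {F. {v. \<alpha> v < 0} \<subseteq> F} p" by (rule exact_at_negative_cone[of \<alpha> v0, OF v0]) auto
      then show ?thesis
        by (rule exact_at_subset) (use mem in \<open>auto simp: power_sets_def\<close>)
    qed
  qed
qed

text \<open>
  The multidegree in which all estimates of the previous proof are equalities: the quotients are
  \<open>n - 1\<close> on the group of largest degree and \<open>0\<close> on the others.
\<close>

definition extremal :: "'n \<Rightarrow> int" where
  "extremal v = (if gr v = 0 then - 1 else if gr v = 1 then int (n * w v) - 1 else int (w v) - 1)"

lemma card_ge: "s \<le> card (UNIV :: 'n set)"
proof -
  have "{1..s} \<subseteq> range gr" using gr_onto by blast
  then have "s \<le> card (range gr)" using card_mono[of "range gr" "{1..s}"] by simp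
  also have "\<dots> \<le> card (UNIV :: 'n set)" by (rule card_image_le) simp
  finally show ?thesis .
qed

lemma sum_extremal: "(\<Sum>v\<in>UNIV. extremal v) + int (Suc (card (UNIV :: 'n set)) - s) = reg"
proof -
  have "(\<Sum>v\<in>UNIV. extremal v) + int (card (UNIV :: 'n set)) = (\<Sum>v\<in>UNIV. extremal v + 1)"
    by (simp add: sum.distrib)
  also have "\<dots> = (\<Sum>v | gr v \<noteq> 0. (if gr v = 1 then int n else 1) * int (w v))"
    by (rule sum.mono_neutral_cong_right) (auto simp: extremal_def)
  also have "\<dots> = (\<Sum>i = 1..s. \<Sum>v | gr v = i. (if gr v = 1 then int n else 1) * int (w v))"
    by (rule sum_groups)
  also have "\<dots> = (\<Sum>i = 1..s. (if i = 1 then int n else 1) * int (group_deg i))"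
    by (intro sum.cong refl) (simp add: group_deg_def sum_distrib_left)
  also have "\<dots> = int n * int (group_deg 1) + (\<Sum>i = 2..s. int (group_deg i))"
    unfolding sum_split_first by simp
  finally show ?thesis using card_ge by (simp add: reg_def of_nat_diff)
qed

text \<open>
  In the extremal multidegree no order \<open>n\<close> can be reached unless a whole group is inverted.
\<close>

lemma power_sets_extremal: "power_sets extremal =
  {F. {v. gr v = 0} \<subseteq> F \<and> (\<exists>i\<in>{1..s}. {v. gr v = i} \<subseteq> F)}" (is "_ = ?D")
proof
  have "extremal v < 0 \<longleftrightarrow> gr v = 0" for v
  proof (cases "gr v = 0")
    case False
    then have "1 \<le> int (w v)" "1 \<le> int (n * w v)" using w_pos[OF False] n by (simp_all flip: of_nat_mult)
    then show ?thesis using False by (simp add: extremal_def del: of_nat_mult)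
  qed (simp add: extremal_def)
  then have neg: "{v. extremal v < 0} = {v. gr v = 0}" by simp
  show "?D \<subseteq> power_sets extremal" using mem_power_sets_if_group_subset[of extremal] unfolding neg by blast
  show "power_sets extremal \<subseteq> ?D"
  proof
    fix F assume "F \<in> power_sets extremal"
    then obtain c where F: "{v. gr v = 0} \<subseteq> F" and c: "n \<le> (\<Sum>i = 1..s. c i)"
      "\<And>v. v \<notin> F \<Longrightarrow> gr v \<noteq> 0 \<Longrightarrow> int (c (gr v) * w v) \<le> extremal v"
      unfolding power_sets_def neg by blast
    have "\<exists>i\<in>{1..s}. {v. gr v = i} \<subseteq> F"
    proof (rule ccontr)
      assume "\<not> ?thesis"
      then have ex: "\<exists>v. v \<notin> F \<and> gr v = i" if "i \<in> {1..s}" for i using that by blast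
      have ci: "c i \<le> (if i = 1 then n - 1 else 0)" if i: "i \<in> {1..s}" for i
      proof -
        obtain v where v: "v \<notin> F" "gr v = i" using ex[OF i] by blast
        then have "int (c i * w v) \<le> extremal v" using c(2)[of v] i by auto
        then have "int (c i * w v) < int ((if i = 1 then n else 1) * w v)"
          using v i by (auto simp: extremal_def)
        then have "c i * w v < (if i = 1 then n else 1) * w v" by (simp only: of_nat_less_iff)
        then have "c i < (if i = 1 then n else 1)" by (simp only: mult_less_cancel2)
        then show ?thesis by (auto split: if_splits)
      qed
      have "(\<Sum>i = 1..s. c i) \<le> (\<Sum>i = 1..s. if i = 1 then n - 1 else 0)"
        by (rule sum_mono) (rule ci)
      also have "\<dots> = n - 1" using s by simp
      finally show False using c(1) n by simp
    qed
    then show "F \<in> ?D" using F by blast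
  qed
qed

lemma not_exact_at_extremal:
  "\<not> exact_at (K :: 'k::field itself) (power_sets extremal) (Suc (card (UNIV :: 'n set)) - s)"
  unfolding power_sets_extremal using s gr_le gr_onto card_ge by (intro not_exact_at_missing_group) auto

lemma degree_sets_powers:
  assumes "monomial_ideal power_exps (J :: ('n, 'k::field) mpoly set)"
  shows "monomial_ideal.degree_sets power_exps \<alpha> = power_sets \<alpha>"
proof -
  interpret monomial_ideal power_exps J by (rule assms)
  show ?thesis
  proof (intro equalityI subsetI)
    fix F assume "F \<in> degree_sets \<alpha>"
    then obtain k where k: "\<And>j. 0 \<le> shift (int k) F \<alpha> j" "expo (shift (int k) F \<alpha>) \<in> power_exps"
      by (auto simp: degree_sets_def in_fraction_def)
    then obtain c where c: "n \<le> (\<Sum>i = 1..s. c i)"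
      "\<And>v. gr v \<noteq> 0 \<Longrightarrow> c (gr v) * w v \<le> nat (shift (int k) F \<alpha> v)" by (auto simp: power_exps_def)
    have out: "shift (int k) F \<alpha> v = \<alpha> v" if "v \<notin> F" for v using that by (simp add: shift_def)
    have "int (c (gr v) * w v) \<le> \<alpha> v" if "v \<notin> F" "gr v \<noteq> 0" for v
      using c(2)[OF that(2)] k(1)[of v] unfolding out[OF that(1)] by linarith
    moreover have "v \<in> F" if "\<alpha> v < 0" for v using k(1)[of v] out[of v] that by linarith
    ultimately show "F \<in> power_sets \<alpha>" using c(1) unfolding power_sets_def by blast
  next
    fix F assume "F \<in> power_sets \<alpha>"
    then obtain c where F: "\<And>v. v \<notin> F \<Longrightarrow> 0 \<le> \<alpha> v" and c: "n \<le> (\<Sum>i = 1..s. c i)"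
      "\<And>v. v \<notin> F \<Longrightarrow> gr v \<noteq> 0 \<Longrightarrow> int (c (gr v) * w v) \<le> \<alpha> v"
      unfolding power_sets_def by (auto simp: subset_iff not_less[symmetric])
    define k where "k = (\<Sum>v\<in>UNIV. nat \<bar>\<alpha> v\<bar> + c (gr v) * w v)"
    have k: "nat \<bar>\<alpha> v\<bar> + c (gr v) * w v \<le> k" for v
      unfolding k_def by (rule member_le_sum) auto
    have sh: "0 \<le> shift (int k) F \<alpha> v \<and> (gr v \<noteq> 0 \<longrightarrow> int (c (gr v) * w v) \<le> shift (int k) F \<alpha> v)" for v
    proof (cases "v \<in> F")
      case True
      have "int (c (gr v) * w v) \<le> \<alpha> v + int k" using k[of v] by linarith
      moreover from this have "0 \<le> \<alpha> v + int k" using of_nat_0_le_iff order_trans by blast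
      ultimately show ?thesis using True by (simp add: shift_def del: of_nat_mult)
    next
      case False
      then show ?thesis using F[OF False] c(2)[OF False] by (simp add: shift_def)
    qed
    have "c (gr v) * w v \<le> nat (shift (int k) F \<alpha> v)" if "gr v \<noteq> 0" for v
      using sh[of v] that by linarith
    then have "expo (shift (int k) F \<alpha>) \<in> power_exps" using c(1) unfolding power_exps_def by auto
    then show "F \<in> degree_sets \<alpha>" using sh by (auto simp: degree_sets_def in_fraction_def)
  qed
qed

lemma monomial_ideal_powers:
  "monomial_ideal power_exps {f :: ('n, 'k::field) mpoly. Poly_Mapping.keys f \<subseteq> power_exps}"
proof
  fix e e' :: "'n \<Rightarrow>\<^sub>0 nat"
  assume "e \<in> power_exps" and le: "\<And>j. Poly_Mapping.lookup e j \<le> Poly_Mapping.lookup e' j"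
  then show "e' \<in> power_exps" unfolding power_exps_def by (blast intro: order_trans)
qed simp

lemma ideal_reg_powers:
  "ideal_reg {f :: ('n, 'k::field) mpoly. Poly_Mapping.keys f \<subseteq> power_exps} = ereal (of_int reg)"
proof -
  interpret monomial_ideal power_exps "{f :: ('n, 'k) mpoly. Poly_Mapping.keys f \<subseteq> power_exps}"
    by (rule monomial_ideal_powers)
  note st = degree_sets_powers[OF monomial_ideal_powers]
  show ?thesis
    by (rule regularity_eqI[OF _ sum_extremal])
      (use exact_at_above_reg not_exact_at_extremal in \<open>auto simp: st\<close>)
qed

end

section \<open>Ideals generated by monomials\<close>

interpretation poly_ring: module "(*) :: 'a::comm_ring_1 \<Rightarrow> 'a \<Rightarrow> 'a"
  by (rule module_mult)

lemma ideal_gen_eq_span: "ideal_gen G = poly_ring.span G"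
  by (simp add: ideal_gen_def)

lemma mem_subspace_by_terms:
  assumes "poly_ring.subspace S"
    and "\<And>e c. e \<in> Poly_Mapping.keys f \<Longrightarrow> Poly_Mapping.single e c \<in> S"
  shows "f \<in> (S :: ('n, 'k::comm_ring_1) mpoly set)"
  by (subst poly_mapping_eq_sum_single) (intro poly_ring.subspace_sum assms)

text \<open>
  The polynomials all of whose monomials are divisible by a generator form an ideal.
\<close>

lemma keys_ideal_gen_monomials:
  fixes f :: "('n::finite, 'k::comm_ring_1) mpoly"
  assumes f: "f \<in> ideal_gen ((\<lambda>i. Poly_Mapping.single (a i) 1) ` X)" and e: "e \<in> Poly_Mapping.keys f"
  shows "\<exists>i\<in>X. \<forall>j. Poly_Mapping.lookup (a i) j \<le> Poly_Mapping.lookup e j"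
proof -
  let ?E = "{e. \<exists>i\<in>X. \<forall>j. Poly_Mapping.lookup (a i) j \<le> Poly_Mapping.lookup e j}"
  have "poly_ring.subspace {f :: ('n, 'k) mpoly. Poly_Mapping.keys f \<subseteq> ?E}"
    by (rule subspace_keys) (blast intro: order_trans)
  moreover have "(\<lambda>i. Poly_Mapping.single (a i) 1) ` X \<subseteq> {f :: ('n, 'k) mpoly. Poly_Mapping.keys f \<subseteq> ?E}"
    by auto
  ultimately have "ideal_gen ((\<lambda>i. Poly_Mapping.single (a i) 1) ` X) \<subseteq>
      {f :: ('n, 'k) mpoly. Poly_Mapping.keys f \<subseteq> ?E}"
    unfolding ideal_gen_def by (intro poly_ring.span_minimal)
  then show ?thesis using f e by auto
qed

text \<open>
  The exponents of the monomials in the \<open>n\<close>-th power of the ideal generated by the monomials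
  with exponents \<open>a 1, \<dots>, a s\<close>; for coprime monomials this is \<open>power_exps\<close>.
\<close>

definition ideal_pow_exps :: "(nat \<Rightarrow> 'n::finite \<Rightarrow>\<^sub>0 nat) \<Rightarrow> nat \<Rightarrow> nat \<Rightarrow> ('n \<Rightarrow>\<^sub>0 nat) set" where
  "ideal_pow_exps a s n = {e. \<exists>c. n \<le> (\<Sum>i = 1..s. c i) \<and>
     (\<forall>j. (\<Sum>i = 1..s. c i * Poly_Mapping.lookup (a i) j) \<le> Poly_Mapping.lookup e j)}"

lemma ideal_pow_exps_up:
  "\<lbrakk>e \<in> ideal_pow_exps a s n; \<And>j. Poly_Mapping.lookup e j \<le> Poly_Mapping.lookup e' j\<rbrakk> \<Longrightarrow> e' \<in> ideal_pow_exps a s n"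
  unfolding ideal_pow_exps_def by (blast intro: order_trans)

lemma sum_fun_upd_Suc:
  fixes h :: "'a \<Rightarrow> nat"
  assumes "finite A" "i \<in> A"
  shows "(\<Sum>k\<in>A. (c(i := Suc (c i))) k * h k) = (\<Sum>k\<in>A. c k * h k) + h i"
proof -
  have "(\<Sum>k\<in>A - {i}. (c(i := Suc (c i))) k * h k) = (\<Sum>k\<in>A - {i}. c k * h k)"
    by (rule sum.cong) auto
  then show ?thesis using assms by (simp add: sum.remove[of _ i])
qed

lemma ideal_pow_exps_Suc:
  "e \<in> ideal_pow_exps a s (Suc n) \<longleftrightarrow> (\<exists>i\<in>{1..s}. \<exists>e'\<in>ideal_pow_exps a s n. e = e' + a i)"
proof
  assume "e \<in> ideal_pow_exps a s (Suc n)"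
  then obtain c where c: "Suc n \<le> (\<Sum>i = 1..s. c i)"
    "\<And>j. (\<Sum>i = 1..s. c i * Poly_Mapping.lookup (a i) j) \<le> Poly_Mapping.lookup e j"
    by (auto simp: ideal_pow_exps_def)
  have "\<exists>i\<in>{1..s}. c i \<noteq> 0"
  proof (rule ccontr)
    assume "\<not> ?thesis"
    then have "(\<Sum>i = 1..s. c i) = 0" by simp
    then show False using c(1) by simp
  qed
  then obtain i where i: "i \<in> {1..s}" "c i \<noteq> 0" by blast
  define c' where "c' = c(i := c i - 1)"
  have "c = c'(i := Suc (c' i))" using i(2) by (auto simp: c'_def)
  then have split: "(\<Sum>k = 1..s. c k * h k) = (\<Sum>k = 1..s. c' k * h k) + h i" for h :: "nat \<Rightarrow> nat"
    using sum_fun_upd_Suc[of "{1..s}" i c' h] i(1) by simp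
  have le: "Poly_Mapping.lookup (a i) j \<le> Poly_Mapping.lookup e j" for j
    using c(2)[of j] unfolding split by simp
  have "e - a i \<in> ideal_pow_exps a s n"
    unfolding ideal_pow_exps_def
  proof (intro CollectI exI[of _ c'] conjI allI)
    show "n \<le> (\<Sum>i = 1..s. c' i)" using c(1) split[of "\<lambda>_. 1"] by simp
    show "(\<Sum>i = 1..s. c' i * Poly_Mapping.lookup (a i) j) \<le> Poly_Mapping.lookup (e - a i) j" for j
      using c(2)[of j] unfolding split lookup_minus by simp
  qed
  moreover have "e = (e - a i) + a i"
    by (rule poly_mapping_eqI) (simp add: lookup_add lookup_minus le)
  ultimately show "\<exists>i\<in>{1..s}. \<exists>e'\<in>ideal_pow_exps a s n. e = e' + a i" using i(1) by blast
next
  assume "\<exists>i\<in>{1..s}. \<exists>e'\<in>ideal_pow_exps a s n. e = e' + a i"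
  then obtain i e' c where i: "i \<in> {1..s}" "e = e' + a i" "n \<le> (\<Sum>i = 1..s. c i)"
    "\<And>j. (\<Sum>i = 1..s. c i * Poly_Mapping.lookup (a i) j) \<le> Poly_Mapping.lookup e' j"
    by (auto simp: ideal_pow_exps_def)
  note split = sum_fun_upd_Suc[of "{1..s}" i, OF finite_atLeastAtMost i(1)]
  show "e \<in> ideal_pow_exps a s (Suc n)"
    unfolding ideal_pow_exps_def
  proof (intro CollectI exI[of _ "c(i := Suc (c i))"] conjI allI)
    show "Suc n \<le> (\<Sum>k = 1..s. (c(i := Suc (c i))) k)" using i(3) split[of c "\<lambda>_. 1"] by simp
    show "(\<Sum>k = 1..s. (c(i := Suc (c i))) k * Poly_Mapping.lookup (a k) j) \<le> Poly_Mapping.lookup e j" for j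
      unfolding split[of c "\<lambda>k. Poly_Mapping.lookup (a k) j"] i(2) lookup_add
      using i(4)[of j] by (rule add_right_mono)
  qed
qed

lemma ideal_pow_monomials:
  fixes a :: "nat \<Rightarrow> 'n::finite \<Rightarrow>\<^sub>0 nat"
  shows "ideal_pow (ideal_gen ((\<lambda>i. Poly_Mapping.single (a i) 1) ` {1..s})) n =
    {f :: ('n, 'k::comm_ring_1) mpoly. Poly_Mapping.keys f \<subseteq> ideal_pow_exps a s n}"
    (is "ideal_pow ?I n = ?S n")
proof (induction n)
  case 0
  have "e \<in> ideal_pow_exps a s 0" for e
    unfolding ideal_pow_exps_def by (intro CollectI exI[of _ "\<lambda>_. 0"]) simp
  then show ?case by auto
next
  case (Suc n)
  have sub: "poly_ring.subspace (?S (Suc n))" by (rule subspace_keys) (rule ideal_pow_exps_up)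
  have "ideal_gen {x * y |x y. x \<in> ?S n \<and> y \<in> ?I} = ?S (Suc n)"
  proof
    have "x * y \<in> ?S (Suc n)" if xy: "x \<in> ?S n" "y \<in> ?I" for x y
    proof (intro CollectI subsetI)
      fix e assume "e \<in> Poly_Mapping.keys (x * y)"
      then obtain e1 e2 where e: "e = e1 + e2" "e1 \<in> Poly_Mapping.keys x" "e2 \<in> Poly_Mapping.keys y"
        using keys_mult[of x y] by blast
      then obtain i where i: "i \<in> {1..s}" "\<forall>j. Poly_Mapping.lookup (a i) j \<le> Poly_Mapping.lookup e2 j"
        using keys_ideal_gen_monomials[OF xy(2)] by blast
      have "e1 + a i \<in> ideal_pow_exps a s (Suc n)"
        unfolding ideal_pow_exps_Suc using i(1) e(2) xy(1) by blast
      then show "e \<in> ideal_pow_exps a s (Suc n)"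
        by (rule ideal_pow_exps_up) (use i(2) in \<open>simp add: e(1) lookup_add\<close>)
    qed
    then show "ideal_gen {x * y |x y. x \<in> ?S n \<and> y \<in> ?I} \<subseteq> ?S (Suc n)"
      unfolding ideal_gen_eq_span[of "{x * y |x y. x \<in> ?S n \<and> y \<in> ?I}"]
      by (intro poly_ring.span_minimal sub) auto
    show "?S (Suc n) \<subseteq> ideal_gen {x * y |x y. x \<in> ?S n \<and> y \<in> ?I}"
    proof
      fix f assume f: "f \<in> ?S (Suc n)"
      show "f \<in> ideal_gen {x * y |x y. x \<in> ?S n \<and> y \<in> ?I}"
        unfolding ideal_gen_eq_span[of "{x * y |x y. x \<in> ?S n \<and> y \<in> ?I}"]
      proof (rule mem_subspace_by_terms[OF poly_ring.subspace_span])
        fix e :: "'n \<Rightarrow>\<^sub>0 nat" and c :: 'k assume "e \<in> Poly_Mapping.keys f"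
        then obtain i e' where e: "i \<in> {1..s}" "e' \<in> ideal_pow_exps a s n" "e = e' + a i"
          using f ideal_pow_exps_Suc[of e a s n] by blast
        have "Poly_Mapping.single e' c \<in> ?S n" using e(2) by simp
        moreover have "Poly_Mapping.single (a i) 1 \<in> ?I"
          unfolding ideal_gen_def using e(1) by (intro poly_ring.span_base) auto
        moreover have "Poly_Mapping.single e c = Poly_Mapping.single e' c * Poly_Mapping.single (a i) 1"
          by (simp add: mult_single e(3))
        ultimately have "Poly_Mapping.single e c \<in> {x * y |x y. x \<in> ?S n \<and> y \<in> ?I}" by blast
        then show "Poly_Mapping.single e c \<in> poly_ring.span {x * y |x y. x \<in> ?S n \<and> y \<in> ?I}"
          by (rule poly_ring.span_base)
      qed
    qed
  qed
  then show ?case by (simp only: ideal_pow.simps Suc.IH)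
qed

lemma deg_single: "deg (Poly_Mapping.single e (1 :: 'k::comm_ring_1)) = mono_deg e"
  by (simp add: deg_def)

text \<open>
  Suppose that \<open>x\<^sub>v\<close> divides \<open>u\<^sub>i\<close> and \<open>u\<^sub>j\<close>, where \<open>i < j\<close>. As \<open>u\<^sub>j\<close> times \<open>u\<^sub>i / x\<^sub>v\<close> is a
  multiple of \<open>u\<^sub>i\<close>, regularity puts \<open>u\<^sub>i / x\<^sub>v\<close> into the ideal of \<open>u\<^sub>1, \<dots>, u\<^bsub>j-1\<^esub>\<close>. Hence it is
  divisible by one of these generators. For degree reasons this is not \<open>u\<^sub>i\<close>, so \<open>u\<^sub>i\<close> is a
  redundant generator.
\<close>

lemma regular_sequence_coprime:
  fixes a :: "nat \<Rightarrow> 'n::finite \<Rightarrow>\<^sub>0 nat"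
  defines "u \<equiv> \<lambda>i. Poly_Mapping.single (a i) (1 :: 'k::comm_ring_1)"
  assumes reg: "regular_sequence (map u [1..<Suc s])"
    and inj: "inj_on u {1..s}"
    and min: "\<And>H. H \<subset> u ` {1..s} \<Longrightarrow> ideal_gen H \<noteq> ideal_gen (u ` {1..s})"
    and ij: "1 \<le> i" "i < j" "j \<le> s"
  shows "Poly_Mapping.lookup (a i) v = 0 \<or> Poly_Mapping.lookup (a j) v = 0"
proof (rule ccontr)
  assume "\<not> ?thesis"
  then have pos: "0 < Poly_Mapping.lookup (a i) v" "0 < Poly_Mapping.lookup (a j) v" by auto
  let ?v = "Poly_Mapping.single v 1 :: 'n \<Rightarrow>\<^sub>0 nat"
  have step: "u ` {1..<j} = set (take (j - 1) (map u [1..<Suc s]))"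
    using ij by (auto simp: take_map take_upt)
  have len: "j - 1 < length (map u [1..<Suc s])" "map u [1..<Suc s] ! (j - 1) = u j"
    using ij by (simp_all del: upt_Suc)
  have "a j + (a i - ?v) = (a j - ?v) + a i"
    by (rule poly_mapping_eqI) (use pos in \<open>auto simp: lookup_add lookup_minus lookup_single when_def\<close>)
  then have swap: "u j * Poly_Mapping.single (a i - ?v) 1 = Poly_Mapping.single (a j - ?v) 1 * u i"
    unfolding u_def mult_single by simp
  let ?f = "Poly_Mapping.single (a i - ?v) (1 :: 'k)"
  have "u j * ?f = Poly_Mapping.single (a j - ?v) 1 * u i" by (rule swap)
  also have "\<dots> \<in> ideal_gen (u ` {1..<j})"
    unfolding ideal_gen_def by (intro poly_ring.span_scale poly_ring.span_base) (use ij in auto)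
  finally have "?f \<in> ideal_gen (u ` {1..<j})"
    using reg len unfolding regular_sequence_def step by metis
  then obtain k where k: "k \<in> {1..<j}"
    "\<And>x. Poly_Mapping.lookup (a k) x \<le> Poly_Mapping.lookup (a i - ?v) x"
    using keys_ideal_gen_monomials[of ?f a "{1..<j}" "a i - ?v"] unfolding u_def by auto
  have "k \<noteq> i" using k(2)[of v] pos(1) by (auto simp: lookup_minus)
  then have "u k \<noteq> u i" using inj_onD[OF inj, of k i] k(1) ij by auto
  then have uk: "u k \<in> u ` {1..s} - {u i}" using k(1) ij by auto
  have "Poly_Mapping.lookup (a k) x \<le> Poly_Mapping.lookup (a i) x" for x
    using k(2)[of x] unfolding lookup_minus by linarith
  then have "a i = (a i - a k) + a k"
    by (intro poly_mapping_eqI) (simp add: lookup_add lookup_minus)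
  then have "u i = Poly_Mapping.single (a i - a k) 1 * u k" unfolding u_def mult_single by simp
  also have "\<dots> \<in> poly_ring.span (u ` {1..s} - {u i})"
    using uk by (intro poly_ring.span_scale poly_ring.span_base)
  finally have "x \<in> poly_ring.span (u ` {1..s} - {u i})" if "x \<in> u ` {1..s}" for x
    using that by (cases "x = u i") (simp, intro poly_ring.span_base, simp)
  then have "u ` {1..s} \<subseteq> poly_ring.span (u ` {1..s} - {u i})" by blast
  then have "ideal_gen (u ` {1..s} - {u i}) = ideal_gen (u ` {1..s})"
    unfolding ideal_gen_eq_span
    by (intro equalityI poly_ring.span_mono poly_ring.span_minimal poly_ring.subspace_span) auto
  moreover have "u ` {1..s} - {u i} \<subset> u ` {1..s}" using ij by auto
  ultimately show False using min by blast
qed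

section \<open>The regularity of powers of monomial complete intersections\<close>

theorem theorem2p1:
  fixes u :: "nat \<Rightarrow> ('n::{finite,linorder}, 'k::field) mpoly"
    and I :: "('n, 'k) mpoly set"
    and s n :: nat
  assumes "s \<ge> 1"
    and "inj_on u {1..s}"
    and "minimal_monomial_generators I (u ` {1..s})"
    and "regular_sequence (map u [1..<Suc s])"
    and "\<And>i j. 1 \<le> i \<Longrightarrow> i \<le> j \<Longrightarrow> j \<le> s \<Longrightarrow> deg (u j) \<le> deg (u i)"
    and "n \<ge> 1"
  shows "ideal_reg (ideal_pow I n) =
    ereal (of_int (int (n * deg (u 1)) + (\<Sum>j = 2..s. int (deg (u j))) - (int s - 1)))"
proof -
  have "\<exists>a. \<forall>i\<in>{1..s}. u i = Poly_Mapping.single (a i) 1"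
    using assms(3) unfolding minimal_monomial_generators_def is_monomial_def by (intro bchoice) auto
  then obtain a where a: "\<And>i. i \<in> {1..s} \<Longrightarrow> u i = Poly_Mapping.single (a i) 1" by blast
  let ?u = "\<lambda>i. Poly_Mapping.single (a i) (1 :: 'k)"
  have img: "u ` {1..s} = ?u ` {1..s}" using a by (intro image_cong) auto
  have seq: "map u [1..<Suc s] = map ?u [1..<Suc s]" using a by auto
  have I: "I = ideal_gen (?u ` {1..s})"
    using assms(3) unfolding minimal_monomial_generators_def img by simp
  have coprime: "Poly_Mapping.lookup (a i) v = 0 \<or> Poly_Mapping.lookup (a j) v = 0"
    if "1 \<le> i" "i < j" "j \<le> s" for i j v
  proof (rule regular_sequence_coprime[OF _ _ _ that])
    show "regular_sequence (map ?u [1..<Suc s])" using assms(4) unfolding seq .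
    show "inj_on ?u {1..s}" using inj_on_cong[of "{1..s}" u ?u, OF a] assms(2) by blast
    show "ideal_gen H \<noteq> ideal_gen (?u ` {1..s})" if "H \<subset> ?u ` {1..s}" for H
      using assms(3) that unfolding minimal_monomial_generators_def img I[symmetric] by blast
  qed
  have nonzero: "\<exists>v. Poly_Mapping.lookup (a i) v \<noteq> 0" if i: "i \<in> {1..s}" for i
  proof (rule ccontr)
    assume "\<not> ?thesis"
    then have "a i = 0" by (intro poly_mapping_eqI) simp
    then have "1 \<in> ?u ` {1..s}" using i by (intro image_eqI[of _ _ i]) auto
    then have "f * 1 \<in> ideal_gen (?u ` {1..s})" for f
      unfolding ideal_gen_def by (intro poly_ring.span_scale poly_ring.span_base)
    then have "ideal_gen (?u ` {1..s}) = UNIV" by auto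
    moreover have "set (map u [1..<Suc s]) = ?u ` {1..s}" unfolding img[symmetric] by auto
    ultimately show False using assms(4) unfolding regular_sequence_def by metis
  qed
  \<comment> \<open>By coprimality at most one generator is divisible by the variable \<open>v\<close>; the value \<open>0\<close> stands for none.\<close>
  define gr where "gr = (\<lambda>v. if \<exists>i\<in>{1..s}. Poly_Mapping.lookup (a i) v \<noteq> 0
    then SOME i. i \<in> {1..s} \<and> Poly_Mapping.lookup (a i) v \<noteq> 0 else 0)"
  define w where "w = (\<lambda>v. Poly_Mapping.lookup (a (gr v)) v)"
  have gr_some: "gr v \<in> {1..s} \<and> Poly_Mapping.lookup (a (gr v)) v \<noteq> 0"
    if "\<exists>i\<in>{1..s}. Poly_Mapping.lookup (a i) v \<noteq> 0" for v
  proof -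
    have ex: "\<exists>i. i \<in> {1..s} \<and> Poly_Mapping.lookup (a i) v \<noteq> 0" using that by blast
    have "gr v = (SOME i. i \<in> {1..s} \<and> Poly_Mapping.lookup (a i) v \<noteq> 0)"
      unfolding gr_def using that by (rule if_P)
    then show ?thesis using someI_ex[OF ex] by simp
  qed
  have gr_none: "gr v = 0" if "\<not> (\<exists>i\<in>{1..s}. Poly_Mapping.lookup (a i) v \<noteq> 0)" for v
    unfolding gr_def using that by (rule if_not_P)
  have lookup_a: "Poly_Mapping.lookup (a i) v = (if gr v = i then w v else 0)" if i: "i \<in> {1..s}" for i v
  proof (cases "gr v = i")
    case False
    have "Poly_Mapping.lookup (a i) v = 0"
    proof (rule ccontr)
      assume nz: "Poly_Mapping.lookup (a i) v \<noteq> 0"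
      then have g: "gr v \<in> {1..s} \<and> Poly_Mapping.lookup (a (gr v)) v \<noteq> 0" using i gr_some by blast
      then show False using coprime[of i "gr v" v] coprime[of "gr v" i v] nz i False
        by (cases "i < gr v") auto
    qed
    then show ?thesis using False by simp
  qed (simp add: w_def)
  have deg: "deg (u i) = (\<Sum>v | gr v = i. w v)" if "i \<in> {1..s}" for i
    using that by (simp add: a deg_single mono_deg_def lookup_a sum.If_cases)
  interpret coprime_powers gr w s n
  proof
    show "gr v \<le> s" for v
      using gr_some[of v] gr_none[of v] by (cases "\<exists>i\<in>{1..s}. Poly_Mapping.lookup (a i) v \<noteq> 0") auto
    show "\<exists>v. gr v = i" if "i \<in> {1..s}" for i
      using nonzero[OF that] lookup_a[OF that] by metis
    show "w v > 0" if "gr v \<noteq> 0" for v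
    proof -
      have "\<exists>i\<in>{1..s}. Poly_Mapping.lookup (a i) v \<noteq> 0" by (rule contrapos_np[OF that gr_none])
      then have "w v \<noteq> 0" unfolding w_def by (rule gr_some[THEN conjunct2])
      then show ?thesis by (rule neq0_conv[THEN iffD1])
    qed
    show "(\<Sum>v | gr v = i. w v) \<le> (\<Sum>v | gr v = 1. w v)" if "i \<in> {1..s}" for i
      using assms(5)[of 1 i] deg[OF that] deg[of 1] that by auto
  qed (use assms in auto)
  have "ideal_pow_exps a s n = power_exps"
  proof -
    have "(\<Sum>i = 1..s. c i * Poly_Mapping.lookup (a i) v) = (if gr v \<noteq> 0 then c (gr v) * w v else 0)" for c v
    proof -
      have "(\<Sum>i = 1..s. c i * Poly_Mapping.lookup (a i) v) = (\<Sum>i = 1..s. if gr v = i then c i * w v else 0)"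
        by (rule sum.cong) (auto simp: lookup_a)
      also have "\<dots> = (if gr v \<in> {1..s} then c (gr v) * w v else 0)" by simp
      finally show ?thesis using gr_le[of v] by auto
    qed
    then show ?thesis unfolding ideal_pow_exps_def power_exps_def by auto
  qed
  then have pow: "ideal_pow I n = {f. Poly_Mapping.keys f \<subseteq> power_exps}"
    unfolding I ideal_pow_monomials by simp
  have "reg = int (n * deg (u 1)) + (\<Sum>j = 2..s. int (deg (u j))) - (int s - 1)"
    unfolding reg_def using s deg by (simp add: group_deg_def)
  then show ?thesis unfolding pow ideal_reg_powers by simp
qed

end
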